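(* Assume that for each $e\in\mathbb{S}^{N-1}$ the homogenized equation $u_t=\nabla\cdot(A^{\rm hom}\nabla u)+\langle B\rangle_A\cdot\nabla u+\bar f(u)$ admits a traveling wave $u(t,x)=\phi_{0,e}(x\cdot e-c_{0,e}t)$ with $\phi_{0,e}(-\infty)=1$, $\phi_{0,e}(+\infty)=0$ and speed $c_{0,e}\in\mathbb{R}$. Let $e\in\mathbb{S}^{N-1}$ be such that $c_{0,e}\neq0$, let $L_*(e)>0$, and for $0<L<L_*(e)$ let $(\phi_{L,e},c_{L,e})$ be a moving pulsating wave (i.e. $c_{L,e}\ne0$) in the direction $e$ connecting $0$ and $1$ of $$u_t=\nabla\cdot(A(x/L)\nabla u)+B(x/L)\cdot\nabla u+f(x/L,u),\qquad t\in\mathbb{R},\ x\in\mathbb{R}^N,$$ such that, after a suitable shift of $\phi_{0,e}$, $\phi_{L,e}-\phi_{0,e}\to0$ in $H^1(\mathbb{R}\times\mathbb{T}^N)$ and $c_{L,e}\to c_{0,e}$ as $L\to0^+$ (such an $L_*(e)$ and such waves exist). Then, for every $0<L<L_*(e)$, $c_{L,e}$ is the unique wave speed and $\phi_{L,e}(\xi,y)$ is unique up to translations in $\xi$; that is, if $(\tilde\phi,\tilde c)$ is any pulsating wave of this equation in the direction $e$ connecting $0$ and $1$, then $\tilde c=c_{L,e}$ and there is $\tau_0\in\mathbb{R}$ with $\tilde\phi(\xi,y)=\phi_{L,e}(\xi+\tau_0,y)$ for all $(\xi,y)\in\mathbb{R}\times\mathbb{T}^N$.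
   Context: Let $N\ge1$ be an integer and $\mathbb{T}^N=\mathbb{R}^N/\mathbb{Z}^N$. The matrix field $A=(A_{ij}):\mathbb{R}^N\to\mathcal{M}_N$ (real $N\times N$ matrices, not assumed symmetric) is $\mathbb{Z}^N$-periodic, of class $C^2$, and there is $\eta_0>0$ with $\sum_{i,j}A_{ij}(x)\xi_i\xi_j\ge\eta_0|\xi|^2$ for all $x,\xi\in\mathbb{R}^N$. The vector field $B:\mathbb{R}^N\to\mathbb{R}^N$ is $\mathbb{Z}^N$-periodic of class $C^1$. The function $f:\mathbb{R}^N\times[0,1]\to\mathbb{R}$ is of class $C^3$, $\mathbb{Z}^N$-periodic in $x$, satisfies $f(x,0)=f(x,1)=0$ for all $x$, and there are $\gamma_0>0$, $\delta_0\in(0,1/2)$ with $\partial_uf(x,u)\le-\gamma_0$ for all $x\in\mathbb{R}^N$, $u\in[0,\delta_0]\cup[1-\delta_0,1]$. Pulsating wave: for $L>0$ and $e\in\mathbb{S}^{N-1}$, a pair $(\phi,c)$ with $\phi:\mathbb{R}\times\mathbb{R}^N\to(0,1)$ and $c\in\mathbb{R}$ is a pulsating wave in the direction $e$ connecting $0$ and $1$ with speed $c$ if (a) $U(t,x)=\phi(x\cdot e-ct,x/L)$ is an entire classical solution of $u_t=\nabla\cdot(A(x/L)\nabla u)+B(x/L)\cdot\nabla u+f(x/L,u)$ on $\mathbb{R}\times\mathbb{R}^N$; (b) $\phi(\xi,y)$ is $\mathbb{Z}^N$-periodic in $y$, and $\lim_{\xi\to-\infty}\phi(\xi,y)=1$,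 $\lim_{\xi\to+\infty}\phi(\xi,y)=0$ uniformly in $y$. It is called moving if $c\ne0$. Homogenized coefficients: for a vector-valued function $\chi$, $\nabla\chi$ is the matrix with $(\nabla\chi)e=\nabla(\chi\cdot e)$ for every $e\in\mathbb{R}^N$; the divergence of a matrix is taken columnwise. $A^{\rm hom}=\int_{\mathbb{T}^N}A(I_N+\nabla\chi)\,dy$, where $\chi:\mathbb{T}^N\to\mathbb{R}^N$ is the unique solution of $\nabla\cdot(A(I_N+\nabla\chi))=0$ in $\mathbb{T}^N$, $\int_{\mathbb{T}^N}\chi\,dy=0$. $\langle B\rangle_A=\int_{\mathbb{T}^N}(B-A^T\nabla\zeta)\,dy$, where $\zeta$ is the unique solution of $\nabla\cdot(A^T\nabla\zeta-B)=0$ in $\mathbb{T}^N$, $\int_{\mathbb{T}^N}\zeta\,dy=0$. $\bar f(u)=\int_{\mathbb{T}^N}f(y,u)\,dy$ for $u\in[0,1]$. The profile $\phi_{0,e}$ takes values in $[0,1]$; for each $e$, $c_{0,e}$ is unique and $\phi_{0,e}$ is decreasing and unique up to shifts. A function of $\xi$ is viewed as a function of $(\xi,y)$ independent of $y$; $H^1(\mathbb{R}\times\mathbb{T}^N)$ consists of functions that are $\mathbb{Z}^N$-periodic in $y$, with the norm of $H^1(\mathbb{R}\times(0,1)^N)$. *)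

theory Defs
  imports "HOL-Analysis.Analysis"
begin

text \<open>
  Functions on the torus are represented by periodic functions on \<open>real ^ 'n\<close>, where \<open>N = CARD('n)\<close>.
\<close>

definition periodic :: "(real ^ 'n \<Rightarrow> 'b) \<Rightarrow> bool" where
  "periodic g \<longleftrightarrow> (\<forall>x k. (\<forall>i. k $ i \<in> \<int>) \<longrightarrow> g (x + k) = g x)"

definition torus_integral :: "(real ^ 'n \<Rightarrow> 'b::{banach, second_countable_topology}) \<Rightarrow> 'b" where
  "torus_integral g = (LINT y:cbox 0 One|lborel. g y)"

text \<open>
  Class \<open>C\<^sup>k\<close> on \<open>S\<close>. Derivatives are taken within \<open>S\<close>, so that on a set such as
  \<open>UNIV \<times> {0..1}\<close> they are one-sided at the boundary; on a convex set with nonempty interior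
  the derivative within \<open>S\<close> is unique.
\<close>

primrec Ck_on :: "nat \<Rightarrow> 'a::euclidean_space set \<Rightarrow> ('a \<Rightarrow> 'b::real_normed_vector) \<Rightarrow> bool" where
  "Ck_on 0 S g \<longleftrightarrow> continuous_on S g"
| "Ck_on (Suc k) S g \<longleftrightarrow>
     (\<exists>g'. (\<forall>x\<in>S. (g has_derivative g' x) (at x within S)) \<and> (\<forall>v. Ck_on k S (\<lambda>x. g' x v)))"

definition smooth :: "('a::euclidean_space \<Rightarrow> 'b::real_normed_vector) \<Rightarrow> bool" where
  "smooth g \<longleftrightarrow> (\<forall>k. Ck_on k UNIV g)"

definition grad :: "(real ^ 'n \<Rightarrow> real) \<Rightarrow> real ^ 'n \<Rightarrow> real ^ 'n" where
  "grad u x = (\<chi> i. frechet_derivative u (at x) (axis i 1))"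

definition divergence :: "(real ^ 'n \<Rightarrow> real ^ 'n) \<Rightarrow> real ^ 'n \<Rightarrow> real" where
  "divergence F x = (\<Sum>i\<in>UNIV. frechet_derivative F (at x) (axis i 1) $ i)"

text \<open>Column \<open>j\<close> is the gradient of the \<open>j\<close>-th component (the transpose of the Jacobian).\<close>

definition grad_matrix :: "(real ^ 'n \<Rightarrow> real ^ 'n) \<Rightarrow> real ^ 'n \<Rightarrow> real ^ 'n ^ 'n" where
  "grad_matrix X x = (\<chi> i j. grad (\<lambda>z. X z $ j) x $ i)"

text \<open>
  Entire classical solutions, of class \<open>C\<^sup>1\<close> in \<open>t\<close> and \<open>C\<^sup>2\<close> in \<open>x\<close>
  with derivatives jointly continuous, of
  \<open>u\<^sub>t = div (A(x) grad u) + B(x) \<bullet> grad u + f(x,u)\<close>.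
\<close>

definition class_C12 :: "(real \<Rightarrow> real ^ 'n \<Rightarrow> real) \<Rightarrow> bool" where
  "class_C12 U \<longleftrightarrow>
     (\<forall>t x. (\<lambda>s. U s x) differentiable (at t)) \<and>
     (\<forall>t x. U t differentiable (at x)) \<and>
     (\<forall>t x. grad (U t) differentiable (at x)) \<and>
     continuous_on UNIV (\<lambda>(t, x). U t x) \<and>
     continuous_on UNIV (\<lambda>(t, x). deriv (\<lambda>s. U s x) t) \<and>
     continuous_on UNIV (\<lambda>(t, x). grad (U t) x) \<and>
     (\<forall>v. continuous_on UNIV (\<lambda>(t, x). frechet_derivative (grad (U t)) (at x) v))"

definition entire_solution ::
  "(real ^ 'n \<Rightarrow> real ^ 'n ^ 'n) \<Rightarrow> (real ^ 'n \<Rightarrow> real ^ 'n) \<Rightarrow> (real ^ 'n \<Rightarrow> real \<Rightarrow> real)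
    \<Rightarrow> (real \<Rightarrow> real ^ 'n \<Rightarrow> real) \<Rightarrow> bool" where
  "entire_solution A B f U \<longleftrightarrow>
     class_C12 U \<and>
     (\<forall>t x. deriv (\<lambda>s. U s x) t =
        divergence (\<lambda>z. A z *v grad (U t) z) x + B x \<bullet> grad (U t) x + f x (U t x))"

definition pulsating_wave ::
  "(real ^ 'n \<Rightarrow> real ^ 'n ^ 'n) \<Rightarrow> (real ^ 'n \<Rightarrow> real ^ 'n) \<Rightarrow> (real ^ 'n \<Rightarrow> real \<Rightarrow> real)
    \<Rightarrow> real \<Rightarrow> real ^ 'n \<Rightarrow> (real \<Rightarrow> real ^ 'n \<Rightarrow> real) \<Rightarrow> real \<Rightarrow> bool" where
  "pulsating_wave A B f L e \<phi> c \<longleftrightarrow>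
     (\<forall>\<xi> y. 0 < \<phi> \<xi> y \<and> \<phi> \<xi> y < 1) \<and>
     entire_solution (\<lambda>x. A (x /\<^sub>R L)) (\<lambda>x. B (x /\<^sub>R L)) (\<lambda>x. f (x /\<^sub>R L))
       (\<lambda>t x. \<phi> (x \<bullet> e - c * t) (x /\<^sub>R L)) \<and>
     (\<forall>\<xi>. periodic (\<phi> \<xi>)) \<and>
     uniform_limit UNIV \<phi> (\<lambda>_. 1) at_bot \<and>
     uniform_limit UNIV \<phi> (\<lambda>_. 0) at_top"

text \<open>
  The cell problems are understood in the weak sense on the torus, for solutions of class \<open>C\<^sup>1\<close>:
  since \<open>B\<close> is only \<open>C\<^sup>1\<close>, the solution of the second one need not be \<open>C\<^sup>2\<close>. By elliptic
  regularity the \<open>H\<^sup>1\<close> weak solutions are \<open>C\<^sup>1\<close>, and this class selects the continuous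
  representative, which makes the solution unique as a function.
\<close>

definition weakly_divergence_free :: "(real ^ 'n \<Rightarrow> real ^ 'n) \<Rightarrow> bool" where
  "weakly_divergence_free F \<longleftrightarrow>
     (\<forall>v. smooth v \<and> periodic v \<longrightarrow> torus_integral (\<lambda>y. F y \<bullet> grad v y) = 0)"

definition is_corrector :: "(real ^ 'n \<Rightarrow> real ^ 'n ^ 'n) \<Rightarrow> (real ^ 'n \<Rightarrow> real ^ 'n) \<Rightarrow> bool" where
  "is_corrector A X \<longleftrightarrow>
     Ck_on 1 UNIV X \<and> periodic X \<and>
     (\<forall>j. weakly_divergence_free (\<lambda>y. column j (A y ** (mat 1 + grad_matrix X y)))) \<and>
     torus_integral X = 0"

definition A_hom :: "(real ^ 'n \<Rightarrow> real ^ 'n ^ 'n) \<Rightarrow> real ^ 'n ^ 'n" where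
  "A_hom A = torus_integral (\<lambda>y. A y ** (mat 1 + grad_matrix (THE X. is_corrector A X) y))"

definition is_drift_corrector ::
  "(real ^ 'n \<Rightarrow> real ^ 'n ^ 'n) \<Rightarrow> (real ^ 'n \<Rightarrow> real ^ 'n) \<Rightarrow> (real ^ 'n \<Rightarrow> real) \<Rightarrow> bool" where
  "is_drift_corrector A B \<zeta> \<longleftrightarrow>
     Ck_on 1 UNIV \<zeta> \<and> periodic \<zeta> \<and>
     weakly_divergence_free (\<lambda>y. transpose (A y) *v grad \<zeta> y - B y) \<and>
     torus_integral \<zeta> = 0"

definition B_hom :: "(real ^ 'n \<Rightarrow> real ^ 'n ^ 'n) \<Rightarrow> (real ^ 'n \<Rightarrow> real ^ 'n) \<Rightarrow> real ^ 'n" where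
  "B_hom A B =
     torus_integral (\<lambda>y. B y - transpose (A y) *v grad (THE \<zeta>. is_drift_corrector A B \<zeta>) y)"

definition f_bar :: "(real ^ 'n \<Rightarrow> real \<Rightarrow> real) \<Rightarrow> real \<Rightarrow> real" where
  "f_bar f u = torus_integral (\<lambda>y. f y u)"

definition homogenized_wave ::
  "(real ^ 'n \<Rightarrow> real ^ 'n ^ 'n) \<Rightarrow> (real ^ 'n \<Rightarrow> real ^ 'n) \<Rightarrow> (real ^ 'n \<Rightarrow> real \<Rightarrow> real)
    \<Rightarrow> real ^ 'n \<Rightarrow> (real \<Rightarrow> real) \<Rightarrow> real \<Rightarrow> bool" where
  "homogenized_wave A B f e \<phi> c \<longleftrightarrow>
     (\<forall>\<xi>. 0 \<le> \<phi> \<xi> \<and> \<phi> \<xi> \<le> 1) \<and>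
     entire_solution (\<lambda>_. A_hom A) (\<lambda>_. B_hom A B) (\<lambda>_. f_bar f) (\<lambda>t x. \<phi> (x \<bullet> e - c * t)) \<and>
     (\<phi> \<longlongrightarrow> 1) at_bot \<and> (\<phi> \<longlongrightarrow> 0) at_top"

text \<open>
  The space \<open>H\<^sup>1(\<real> \<times> T)\<close>, \<open>T\<close> the torus: functions on \<open>real \<times> (real ^ 'n)\<close>, periodic in the
  second variable, with weak gradient on the whole space (so that there is no jump across the
  faces of the unit cell), and the norm computed over one period.
\<close>

definition weak_gradient ::
  "('a::euclidean_space \<Rightarrow> real) \<Rightarrow> ('a \<Rightarrow> 'a) \<Rightarrow> bool" where
  "weak_gradient w G \<longleftrightarrow>
     (\<forall>\<psi>. smooth \<psi> \<and> bounded {p. \<psi> p \<noteq> 0} \<longrightarrow>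
        (\<forall>v. (LINT p|lebesgue. w p * frechet_derivative \<psi> (at p) v)
              = - (LINT p|lebesgue. (G p \<bullet> v) * \<psi> p)))"

definition period_strip :: "(real \<times> (real ^ 'n)) set" where
  "period_strip = UNIV \<times> box 0 One"

definition is_H1_gradient ::
  "(real \<times> (real ^ 'n) \<Rightarrow> real) \<Rightarrow> (real \<times> (real ^ 'n) \<Rightarrow> real \<times> (real ^ 'n)) \<Rightarrow> bool" where
  "is_H1_gradient w G \<longleftrightarrow>
     (\<forall>\<xi>. periodic (\<lambda>y. w (\<xi>, y))) \<and> (\<forall>\<xi>. periodic (\<lambda>y. G (\<xi>, y))) \<and>
     w \<in> borel_measurable lebesgue \<and> G \<in> borel_measurable lebesgue \<and>
     set_integrable lebesgue period_strip (\<lambda>p. (w p)\<^sup>2) \<and>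
     set_integrable lebesgue period_strip (\<lambda>p. (norm (G p))\<^sup>2) \<and>
     weak_gradient w G"

definition H1_space :: "(real \<times> (real ^ 'n) \<Rightarrow> real) set" where
  "H1_space = {w. \<exists>G. is_H1_gradient w G}"

definition H1_norm :: "(real \<times> (real ^ 'n) \<Rightarrow> real) \<Rightarrow> real" where
  "H1_norm w = sqrt (LINT p:period_strip|lebesgue.
     (w p)\<^sup>2 + (norm ((SOME G. is_H1_gradient w G) p))\<^sup>2)"

definition H1_tendsto_zero :: "('i \<Rightarrow> real \<times> (real ^ 'n) \<Rightarrow> real) \<Rightarrow> 'i filter \<Rightarrow> bool" where
  "H1_tendsto_zero w F \<longleftrightarrow>
     (\<forall>\<^sub>F i in F. w i \<in> H1_space) \<and> ((\<lambda>i. H1_norm (w i)) \<longlongrightarrow> 0) F"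

end

theory Submission
  imports Defs
begin

text \<open>
  For each fixed \<open>L\<close>, uniqueness rests on comparison principles alone. Since \<open>f\<close> decreases in \<open>u\<close> near
  0 and near 1, two solutions that are ordered up to these zones are ordered on every ancient time
  interval. If two waves had different speeds, the faster one would lie below the slower one for very
  negative times, hence for all times, and could not overtake it; so the speeds agree. Given two waves
  with the same speed \<open>c \<noteq> 0\<close>, slide the first one down to the last position at which it still lies
  above the second. The profiles must touch there, for otherwise compactness of the transition zone
  and the stability of the tails would allow further sliding, and the strong maximum principle forces
  them to coincide. The condition \<open>c \<noteq> 0\<close> makes the profiles continuous and identifies translations in
  \<open>\<xi>\<close> with translations in time.
\<close>

text \<open>The obstacle is noncompactness: the domain is unbounded in space and in past time, and
  solutions carry only the regularity of \<open>class_C12\<close>. No limits of translated solutions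
  are taken. Every comparison instead looks at one point where an explicit perturbation of the
  difference of two solutions attains its maximum, so that pointwise derivatives suffice. In the
  infinite past there is no initial datum; its place is taken by an absorption term, which is
  present where the difference is positive and both values lie in the same stable zone, and which
  outweighs a small penalty of linear growth. Two features of the equation shape the details. The
  matrix A need not be symmetric, so the sign of the second-order term at a maximum rests on the
  symmetry of the Hessian, which is derived from differentiability of the gradient at the point
  alone. The coefficients depend on x, so only integer translations of x / L and arbitrary time
  shifts preserve the equation; both are used to connect points of the profile.\<close>

section \<open>Second-order conditions at a maximum\<close>

text \<open>The mean value theorem along \<open>v\<close>, applied to the increment of
  \<open>u\<close> by \<open>s *\<^sub>R w\<close>, leaves a difference of two gradients. Both are
  expanded at \<open>x\<close> itself, so differentiability of \<open>g\<close> at this one point is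
  enough; the factor 2 counts the two remainders.\<close>

lemma second_difference_bound:
  fixes u :: "'a::euclidean_space \<Rightarrow> real"
  assumes du: "\<And>x. (u has_derivative (\<lambda>h. g x \<bullet> h)) (at x)"
    and dg: "(g has_derivative H) (at x)" and "\<epsilon> > 0"
  shows "\<exists>d>0. \<forall>s. 0 < s \<and> s < d \<longrightarrow>
    \<bar>u (x + s *\<^sub>R v + s *\<^sub>R w) - u (x + s *\<^sub>R v) - u (x + s *\<^sub>R w) + u x - s\<^sup>2 * (H w \<bullet> v)\<bar>
      \<le> 2 * \<epsilon> * (norm v + norm w)\<^sup>2 * s\<^sup>2"
proof -
  obtain d where d: "d > 0"
    "\<And>y. norm (y - x) < d \<Longrightarrow> norm (g y - g x - H (y - x)) \<le> \<epsilon> * norm (y - x)"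
    using dg \<open>\<epsilon> > 0\<close> unfolding has_derivative_at_alt by metis
  have lin: "linear H" using dg has_derivative_linear by blast
  define M where "M = norm v + norm w"
  have M: "M \<ge> 0" "norm v \<le> M" by (auto simp: M_def)
  have main: "\<bar>u (x + s *\<^sub>R v + s *\<^sub>R w) - u (x + s *\<^sub>R v) - u (x + s *\<^sub>R w) + u x - s\<^sup>2 * (H w \<bullet> v)\<bar>
      \<le> 2 * \<epsilon> * M\<^sup>2 * s\<^sup>2" if s: "0 < s" "s < d / (M + 1)" for s
  proof -
    have sM: "s * M < d"
    proof -
      have "s * M \<le> s * (M + 1)" using s by simp
      also have "\<dots> < d" using s M by (simp add: field_simps)
      finally show ?thesis .
    qed
    define F where "F = (\<lambda>\<theta>. u (x + \<theta> *\<^sub>R v + s *\<^sub>R w) - u (x + \<theta> *\<^sub>R v))"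
    have dF: "(F has_derivative (\<lambda>h. h * ((g (x + \<theta> *\<^sub>R v + s *\<^sub>R w) - g (x + \<theta> *\<^sub>R v)) \<bullet> v))) (at \<theta>)" for \<theta>
      unfolding F_def
      by (rule has_derivative_eq_rhs, rule has_derivative_diff,
          (rule has_derivative_compose[OF _ du], (rule derivative_eq_intros refl)+)+)
        (simp add: fun_eq_iff algebra_simps)
    obtain \<theta> where \<theta>: "0 < \<theta>" "\<theta> < s"
        "F s - F 0 = (s - 0) * ((g (x + \<theta> *\<^sub>R v + s *\<^sub>R w) - g (x + \<theta> *\<^sub>R v)) \<bullet> v)"
      using mvt_simple[OF s(1), of F, OF has_derivative_at_withinI[OF dF]] by auto
    define r1 where "r1 = g (x + \<theta> *\<^sub>R v + s *\<^sub>R w) - g x - H (\<theta> *\<^sub>R v + s *\<^sub>R w)"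
    define r2 where "r2 = g (x + \<theta> *\<^sub>R v) - g x - H (\<theta> *\<^sub>R v)"
    have n1: "norm (\<theta> *\<^sub>R v + s *\<^sub>R w) \<le> s * M"
    proof -
      have "norm (\<theta> *\<^sub>R v + s *\<^sub>R w) \<le> \<theta> * norm v + s * norm w"
        by (rule order_trans[OF norm_triangle_ineq]) (use \<theta> s in simp)
      also have "\<dots> \<le> s * norm v + s * norm w"
        using \<theta> by (simp add: mult_right_mono)
      finally show ?thesis by (simp add: M_def algebra_simps)
    qed
    have n2: "norm (\<theta> *\<^sub>R v) \<le> s * M"
      using \<theta> M s by (simp add: mult_mono)
    have r1: "norm r1 \<le> \<epsilon> * (s * M)"
    proof -
      have "norm r1 \<le> \<epsilon> * norm (\<theta> *\<^sub>R v + s *\<^sub>R w)"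
        using d(2)[of "x + \<theta> *\<^sub>R v + s *\<^sub>R w"] n1 sM by (simp add: r1_def add.assoc)
      also have "\<dots> \<le> \<epsilon> * (s * M)" using n1 \<open>\<epsilon> > 0\<close> by simp
      finally show ?thesis .
    qed
    have r2: "norm r2 \<le> \<epsilon> * (s * M)"
    proof -
      have "norm r2 \<le> \<epsilon> * norm (\<theta> *\<^sub>R v)"
        using d(2)[of "x + \<theta> *\<^sub>R v"] n2 sM unfolding r2_def by simp
      also have "\<dots> \<le> \<epsilon> * (s * M)" using n2 \<open>\<epsilon> > 0\<close> by simp
      finally show ?thesis .
    qed
    have D: "g (x + \<theta> *\<^sub>R v + s *\<^sub>R w) - g (x + \<theta> *\<^sub>R v) = s *\<^sub>R H w + (r1 - r2)"
      unfolding r1_def r2_def by (simp add: linear_add[OF lin] linear_cmul[OF lin])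
    have eq: "F s - F 0 - s\<^sup>2 * (H w \<bullet> v) = s * ((r1 - r2) \<bullet> v)"
      unfolding \<theta>(3) D by (simp add: inner_add_left power2_eq_square algebra_simps)
    have "\<bar>(r1 - r2) \<bullet> v\<bar> \<le> norm (r1 - r2) * norm v" by (rule Cauchy_Schwarz_ineq2)
    also have "\<dots> \<le> (\<epsilon> * (s * M) + \<epsilon> * (s * M)) * M"
      by (rule mult_mono[OF order_trans[OF norm_triangle_ineq4 add_mono[OF r1 r2]]])
        (use M s \<open>\<epsilon> > 0\<close> in auto)
    finally have "\<bar>(r1 - r2) \<bullet> v\<bar> \<le> 2 * \<epsilon> * M\<^sup>2 * s" by (simp add: power2_eq_square algebra_simps)
    then have "s * \<bar>(r1 - r2) \<bullet> v\<bar> \<le> s * (2 * \<epsilon> * M\<^sup>2 * s)" using s by simp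
    then have "\<bar>F s - F 0 - s\<^sup>2 * (H w \<bullet> v)\<bar> \<le> 2 * \<epsilon> * M\<^sup>2 * s\<^sup>2"
      using s unfolding eq abs_mult by (simp add: power2_eq_square mult.assoc mult.left_commute)
    then show ?thesis by (simp add: F_def algebra_simps)
  qed
  have "d / (M + 1) > 0" using d M by simp
  then show ?thesis using main unfolding M_def by blast
qed

text \<open>The second difference is symmetric in \<open>v\<close> and \<open>w\<close>, while its
  two expansions have the leading terms \<open>H w \<bullet> v\<close> and
  \<open>H v \<bullet> w\<close>.\<close>

lemma hessian_symmetric:
  fixes u :: "'a::euclidean_space \<Rightarrow> real"
  assumes du: "\<And>x. (u has_derivative (\<lambda>h. g x \<bullet> h)) (at x)"
    and dg: "(g has_derivative H) (at x)"
  shows "H v \<bullet> w = H w \<bullet> v"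
proof (rule ccontr)
  assume neq: "H v \<bullet> w \<noteq> H w \<bullet> v"
  define K where "K = (norm v + norm w)\<^sup>2 + 1"
  have K: "K > 0" unfolding K_def by (smt (verit) zero_le_power2)
  \<comment> \<open>The two errors add up to at most 4 \<epsilon> K times s squared; the factor 8
    makes this half of the supposed discrepancy.\<close>
  define \<epsilon> where "\<epsilon> = \<bar>H v \<bullet> w - H w \<bullet> v\<bar> / (8 * K)"
  have e: "\<epsilon> > 0" using neq K by (simp add: \<epsilon>_def)
  obtain d1 where d1: "d1 > 0" "\<And>s. 0 < s \<Longrightarrow> s < d1 \<Longrightarrow>
    \<bar>u (x + s *\<^sub>R v + s *\<^sub>R w) - u (x + s *\<^sub>R v) - u (x + s *\<^sub>R w) + u x - s\<^sup>2 * (H w \<bullet> v)\<bar>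
      \<le> 2 * \<epsilon> * (norm v + norm w)\<^sup>2 * s\<^sup>2"
    using second_difference_bound[OF du dg e, of v w] by blast
  obtain d2 where d2: "d2 > 0" "\<And>s. 0 < s \<Longrightarrow> s < d2 \<Longrightarrow>
    \<bar>u (x + s *\<^sub>R w + s *\<^sub>R v) - u (x + s *\<^sub>R w) - u (x + s *\<^sub>R v) + u x - s\<^sup>2 * (H v \<bullet> w)\<bar>
      \<le> 2 * \<epsilon> * (norm w + norm v)\<^sup>2 * s\<^sup>2"
    using second_difference_bound[OF du dg e, of w v] by blast
  define s where "s = min d1 d2 / 2"
  have s: "0 < s" "s < d1" "s < d2" using d1(1) d2(1) by (auto simp: s_def)
  have "x + s *\<^sub>R w + s *\<^sub>R v = x + s *\<^sub>R v + s *\<^sub>R w" by simp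
  then have "\<bar>s\<^sup>2 * (H v \<bullet> w) - s\<^sup>2 * (H w \<bullet> v)\<bar> \<le> 4 * \<epsilon> * (norm v + norm w)\<^sup>2 * s\<^sup>2"
    using d1(2)[OF s(1,2)] d2(2)[OF s(1,3)]
    by (simp only: add.commute[of "norm w"])
  then have "s\<^sup>2 * \<bar>H v \<bullet> w - H w \<bullet> v\<bar> \<le> s\<^sup>2 * (4 * \<epsilon> * (norm v + norm w)\<^sup>2)"
    by (simp add: abs_mult flip: right_diff_distrib) (simp add: algebra_simps)
  then have "\<bar>H v \<bullet> w - H w \<bullet> v\<bar> \<le> 4 * \<epsilon> * (norm v + norm w)\<^sup>2"
    using s(1) by (simp add: mult_le_cancel_left_pos)
  also have "\<dots> \<le> 4 * \<epsilon> * K" using e by (simp add: K_def)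
  also have "\<dots> = \<bar>H v \<bullet> w - H w \<bullet> v\<bar> / 2" using K by (simp add: \<epsilon>_def)
  finally show False using neq by simp
qed

text \<open>If the second derivative along \<open>v\<close> were positive, the first derivative
  along this line, which vanishes at the maximum, would be positive just beyond it and
  \<open>u\<close> would increase. This argument replaces a Taylor expansion.\<close>

lemma local_max_gradient_hessian:
  fixes u :: "'a::euclidean_space \<Rightarrow> real"
  assumes du: "\<And>x. (u has_derivative (\<lambda>h. g x \<bullet> h)) (at x)"
    and dg: "(g has_derivative H) (at x)"
    and loc: "open S" "x \<in> S" "\<And>y. y \<in> S \<Longrightarrow> u y \<le> u x"
  shows "g x = 0" and "H v \<bullet> v \<le> 0"
proof -
  have "(\<lambda>h. g x \<bullet> h) = (\<lambda>h. 0)"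
    using differential_zero_maxmin[OF loc(2,1) du[of x]] loc(3) by blast
  then have "g x \<bullet> g x = 0" by metis
  then show g0: "g x = 0" by simp
  show "H v \<bullet> v \<le> 0"
  proof (rule ccontr)
    assume "\<not> H v \<bullet> v \<le> 0"
    define F where "F = (\<lambda>s. u (x + s *\<^sub>R v))"
    define F' where "F' = (\<lambda>s. g (x + s *\<^sub>R v) \<bullet> v)"
    have lin: "linear H" using dg has_derivative_linear by blast
    have dF: "(F has_real_derivative F' s) (at s)" for s
      unfolding F_def F'_def has_field_derivative_def
      by (rule has_derivative_eq_rhs, rule has_derivative_compose[OF _ du],
          (rule derivative_eq_intros refl)+) (simp add: fun_eq_iff)
    have dg': "(g has_derivative H) (at (x + 0 *\<^sub>R v))" using dg by simp
    have "((\<lambda>s. g (x + s *\<^sub>R v)) has_derivative (\<lambda>h. H (h *\<^sub>R v))) (at 0)"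
      by (rule has_derivative_compose[where f="\<lambda>s. x + s *\<^sub>R v", OF _ dg'])
        (auto intro!: derivative_eq_intros)
    then have "(F' has_real_derivative (H v \<bullet> v)) (at 0)"
      unfolding F'_def has_field_derivative_def
      by (auto intro!: derivative_eq_intros simp: linear_cmul[OF lin])
    from DERIV_pos_inc_right[OF this] \<open>\<not> H v \<bullet> v \<le> 0\<close>
    obtain d where d: "d > 0" "\<And>h. 0 < h \<Longrightarrow> h < d \<Longrightarrow> F' 0 < F' h" by force
    have F'0: "F' 0 = 0" by (simp add: F'_def g0)
    have "\<forall>\<^sub>F s in at_right (0::real). x + s *\<^sub>R v \<in> S"
    proof -
      have "((\<lambda>s. x + s *\<^sub>R v) \<longlongrightarrow> x + 0 *\<^sub>R v) (at_right (0::real))" by (intro tendsto_intros)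
      then show ?thesis using loc by (auto dest: topological_tendstoD)
    qed
    then obtain d2 where d2: "d2 > 0" "\<And>s. 0 < s \<Longrightarrow> s < d2 \<Longrightarrow> x + s *\<^sub>R v \<in> S"
      unfolding eventually_at_right_field by auto
    define s where "s = min d d2 / 2"
    have s: "0 < s" "s < d" "s < d2" using d d2 by (auto simp: s_def)
    have "F 0 < F s"
      by (rule DERIV_pos_imp_increasing_open[OF s(1)])
        (use dF d(2) s F'0 in \<open>force intro: DERIV_isCont continuous_at_imp_continuous_on\<close>)+
    moreover have "F s \<le> F 0" using loc(3)[OF d2(2)[OF s(1,3)]] by (simp add: F_def)
    ultimately show False by simp
  qed
qed

section \<open>Pairing of an elliptic matrix with a negative semidefinite Hessian\<close>

text \<open>Induction by Schur complements, which splits off one rank-one form at a time.\<close>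

lemma posdef_sum_nonpos:
  fixes a h :: "'i \<Rightarrow> 'i \<Rightarrow> real"
  assumes "finite S"
    and "\<And>i j. a i j = a j i"
    and "\<And>\<xi>. \<exists>i\<in>S. \<xi> i \<noteq> 0 \<Longrightarrow> (\<Sum>i\<in>S. \<Sum>j\<in>S. a i j * \<xi> i * \<xi> j) > 0"
    and "\<And>\<xi>. (\<Sum>i\<in>S. \<Sum>j\<in>S. h i j * \<xi> i * \<xi> j) \<le> 0"
  shows "(\<Sum>i\<in>S. \<Sum>j\<in>S. a i j * h i j) \<le> 0"
  using assms
proof (induction S arbitrary: a rule: finite_induct)
  case empty
  then show ?case by simp
next
  case (insert k S)
  note split = sum.insert[OF insert.hyps] sum.distrib
  have nk: "i \<in> S \<Longrightarrow> i \<noteq> k" for i using insert.hyps by auto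
  have akk: "a k k > 0"
  proof -
    have "(\<Sum>i\<in>S. a i k * (if i = k then 1 else 0) * 1) = 0"
      "(\<Sum>j\<in>S. a k j * 1 * (if j = k then 1 else 0)) = 0"
      "(\<Sum>i\<in>S. \<Sum>j\<in>S. a i j * (if i = k then 1 else 0) * (if j = k then 1 else 0)) = 0"
      using nk by (auto intro!: sum.neutral)
    then show ?thesis using insert.prems(2)[of "\<lambda>i. if i = k then 1 else 0"]
      by (simp add: split)
  qed
  \<comment> \<open>The Schur complement of the pivot \<open>a k k\<close>: row and column
    \<open>k\<close> of \<open>a'\<close> vanish.\<close>
  define a' where "a' = (\<lambda>i j. a i j - a i k * a k j / a k k)"
  have IH: "(\<Sum>i\<in>S. \<Sum>j\<in>S. a' i j * h i j) \<le> 0"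
  proof (rule insert.IH)
    show "a' i j = a' j i" for i j
      using insert.prems(1) by (simp add: a'_def mult.commute)
    show "(\<Sum>i\<in>S. \<Sum>j\<in>S. a' i j * \<xi> i * \<xi> j) > 0" if "\<exists>i\<in>S. \<xi> i \<noteq> 0" for \<xi>
    proof -
      define m where "m = (\<Sum>j\<in>S. a k j * \<xi> j)"
      \<comment> \<open>This value of coordinate \<open>k\<close> minimizes the quadratic form of
        \<open>a\<close> with the other coordinates fixed; the minimum is the form of
        \<open>a'\<close>.\<close>
      define \<xi>' where "\<xi>' = \<xi>(k := - m / a k k)"
      have "\<exists>i\<in>insert k S. \<xi>' i \<noteq> 0" using that nk by (auto simp: \<xi>'_def)
      then have "0 < (\<Sum>i\<in>insert k S. \<Sum>j\<in>insert k S. a i j * \<xi>' i * \<xi>' j)"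
        by (rule insert.prems(2))
      also have "\<dots> = a k k * \<xi>' k * \<xi>' k + (\<Sum>j\<in>S. a k j * \<xi>' k * \<xi>' j)
          + ((\<Sum>i\<in>S. a i k * \<xi>' i * \<xi>' k) + (\<Sum>i\<in>S. \<Sum>j\<in>S. a i j * \<xi>' i * \<xi>' j))"
        by (simp add: split)
      also have "(\<Sum>j\<in>S. a k j * \<xi>' k * \<xi>' j) = \<xi>' k * m"
        unfolding m_def sum_distrib_left by (rule sum.cong) (auto simp: \<xi>'_def nk)
      also have "(\<Sum>i\<in>S. a i k * \<xi>' i * \<xi>' k) = \<xi>' k * m"
        unfolding m_def sum_distrib_left
        by (rule sum.cong) (use insert.prems(1) in \<open>auto simp: \<xi>'_def nk\<close>)
      also have "(\<Sum>i\<in>S. \<Sum>j\<in>S. a i j * \<xi>' i * \<xi>' j) = (\<Sum>i\<in>S. \<Sum>j\<in>S. a i j * \<xi> i * \<xi> j)"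
        by (intro sum.cong) (auto simp: \<xi>'_def nk)
      also have "(\<Sum>i\<in>S. \<Sum>j\<in>S. a i j * \<xi> i * \<xi> j)
          = (\<Sum>i\<in>S. \<Sum>j\<in>S. a' i j * \<xi> i * \<xi> j) + m * m / a k k"
      proof -
        have "m * m / a k k = (\<Sum>i\<in>S. \<Sum>j\<in>S. (a k i * \<xi> i) * (a k j * \<xi> j)) / a k k"
          unfolding m_def sum_product ..
        also have "\<dots> = (\<Sum>i\<in>S. \<Sum>j\<in>S. a i k * a k j / a k k * \<xi> i * \<xi> j)"
          unfolding sum_divide_distrib
          by (intro sum.cong) (use insert.prems(1) in \<open>auto simp: field_simps\<close>)
        finally show ?thesis
          by (simp add: a'_def left_diff_distrib sum_subtractf)
      qed
      finally show ?thesis using akk by (simp add: \<xi>'_def field_simps)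
    qed
    show "(\<Sum>i\<in>S. \<Sum>j\<in>S. h i j * \<xi> i * \<xi> j) \<le> 0" for \<xi>
    proof -
      define \<xi>' where "\<xi>' = \<xi>(k := 0)"
      have "(\<Sum>i\<in>S. \<Sum>j\<in>S. h i j * \<xi> i * \<xi> j) = (\<Sum>i\<in>S. \<Sum>j\<in>S. h i j * \<xi>' i * \<xi>' j)"
        by (intro sum.cong) (auto simp: \<xi>'_def nk)
      also have "\<dots> = (\<Sum>i\<in>insert k S. \<Sum>j\<in>insert k S. h i j * \<xi>' i * \<xi>' j)"
        by (simp add: split \<xi>'_def)
      also have "\<dots> \<le> 0" by (rule insert.prems(3))
      finally show ?thesis .
    qed
  qed
  have "(\<Sum>i\<in>insert k S. \<Sum>j\<in>insert k S. a i j * h i j)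
      = (\<Sum>i\<in>insert k S. \<Sum>j\<in>insert k S. a i k * a k j / a k k * h i j)
        + (\<Sum>i\<in>insert k S. \<Sum>j\<in>insert k S. a' i j * h i j)"
    unfolding a'_def by (simp add: left_diff_distrib sum_subtractf)
  \<comment> \<open>The rank-one part pairs with \<open>h\<close> to the form of \<open>h\<close> at
    the vector \<open>a k\<close>, divided by the pivot, hence it is nonpositive.\<close>
  also have "(\<Sum>i\<in>insert k S. \<Sum>j\<in>insert k S. a i k * a k j / a k k * h i j)
      = (\<Sum>i\<in>insert k S. \<Sum>j\<in>insert k S. h i j * a k i * a k j) / a k k"
    unfolding sum_divide_distrib
    by (intro sum.cong) (use insert.prems(1) in \<open>auto simp: field_simps\<close>)
  also have "(\<Sum>i\<in>insert k S. \<Sum>j\<in>insert k S. a' i j * h i j) = (\<Sum>i\<in>S. \<Sum>j\<in>S. a' i j * h i j)"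
    using akk insert.prems(1) by (simp add: split a'_def)
  finally show ?case
    using IH insert.prems(3)[of "a k"] akk
    by (smt (verit) divide_nonpos_pos)
qed

text \<open>With \<open>H\<close> the derivative of a gradient this is the trace of a times the
  Hessian, the second-order part of an operator in nondivergence form. \<open>H\<close> remains a
  map because \<open>has_derivative\<close> supplies one.\<close>

definition tr_hess :: "real ^ 'n ^ 'n \<Rightarrow> (real ^ 'n \<Rightarrow> real ^ 'n) \<Rightarrow> real" where
  "tr_hess a H = (\<Sum>i\<in>UNIV. (a *v H (axis i 1)) $ i)"

lemma tr_hess_diff: "tr_hess a (\<lambda>v. H v - G v) = tr_hess a H - tr_hess a G"
  by (simp add: tr_hess_def matrix_vector_mult_diff_distrib sum_subtractf)

lemma tr_hess_scale: "tr_hess a (\<lambda>v. c *\<^sub>R H v) = c * tr_hess a H"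
  by (simp add: tr_hess_def matrix_vector_mult_scaleR sum_distrib_left)

definition elliptic :: "real \<Rightarrow> real ^ 'n ^ 'n \<Rightarrow> bool" where
  "elliptic \<eta> a \<longleftrightarrow> (\<forall>\<xi>. (\<Sum>i\<in>UNIV. \<Sum>j\<in>UNIV. a $ i $ j * \<xi> $ i * \<xi> $ j) \<ge> \<eta> * (norm \<xi>)\<^sup>2)"

text \<open>The symmetric part \<open>s\<close> of \<open>a\<close> has the same quadratic form as
  \<open>a\<close> and the same pairing with the symmetric \<open>h\<close>, so the symmetric case
  applies to \<open>s\<close>.\<close>

lemma tr_hess_nonpos:
  fixes a :: "real ^ 'n ^ 'n"
  assumes a: "elliptic \<eta> a" "\<eta> > 0"
    and lin: "linear H" and sym: "\<And>v w. H v \<bullet> w = H w \<bullet> v" and neg: "\<And>v. H v \<bullet> v \<le> 0"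
  shows "tr_hess a H \<le> 0"
proof -
  define h where "h = (\<lambda>i j. H (axis i 1) $ j)"
  have hsym: "h i j = h j i" for i j
    using sym[of "axis i 1" "axis j 1"] by (simp add: h_def inner_axis)
  define s where "s = (\<lambda>i j. (a $ i $ j + a $ j $ i) / 2)"
  have tr: "tr_hess a H = (\<Sum>i\<in>UNIV. \<Sum>j\<in>UNIV. a $ i $ j * h i j)"
    by (simp add: tr_hess_def h_def matrix_vector_mult_def)
  have swap: "(\<Sum>i\<in>UNIV. \<Sum>j\<in>UNIV. a $ j $ i * k i j) = (\<Sum>i\<in>UNIV. \<Sum>j\<in>UNIV. a $ i $ j * k j i)"
    for k :: "'n \<Rightarrow> 'n \<Rightarrow> real"
    by (rule sum.swap)
  have half: "(\<Sum>i\<in>UNIV. \<Sum>j\<in>UNIV. s i j * k i j) = (\<Sum>i\<in>UNIV. \<Sum>j\<in>UNIV. a $ i $ j * k i j)"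
    if "\<And>i j. k i j = k j i" for k :: "'n \<Rightarrow> 'n \<Rightarrow> real"
  proof -
    have "2 * (\<Sum>i\<in>UNIV. \<Sum>j\<in>UNIV. s i j * k i j)
        = (\<Sum>i\<in>UNIV. \<Sum>j\<in>UNIV. a $ i $ j * k i j) + (\<Sum>i\<in>UNIV. \<Sum>j\<in>UNIV. a $ j $ i * k i j)"
      unfolding s_def sum_distrib_left sum.distrib[symmetric]
      by (intro sum.cong) (auto simp: field_simps)
    also have "(\<Sum>i\<in>UNIV. \<Sum>j\<in>UNIV. a $ j $ i * k i j) = (\<Sum>i\<in>UNIV. \<Sum>j\<in>UNIV. a $ i $ j * k i j)"
      unfolding swap by (intro sum.cong refl arg_cong2[of _ _ _ _ "(*)"] that)
    finally show ?thesis by simp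
  qed
  have "(\<Sum>i\<in>UNIV. \<Sum>j\<in>UNIV. s i j * h i j) \<le> 0"
  proof (rule posdef_sum_nonpos)
    show "s i j = s j i" for i j by (simp add: s_def)
    show "0 < (\<Sum>i\<in>UNIV. \<Sum>j\<in>UNIV. s i j * \<xi> i * \<xi> j)" if "\<exists>i\<in>UNIV. \<xi> i \<noteq> 0" for \<xi>
    proof -
      define x :: "real ^ 'n" where "x = (\<chi> i. \<xi> i)"
      have "x \<noteq> 0" using that by (auto simp: x_def vec_eq_iff)
      then have "0 < \<eta> * (norm x)\<^sup>2" using a(2) by simp
      also have "\<dots> \<le> (\<Sum>i\<in>UNIV. \<Sum>j\<in>UNIV. a $ i $ j * (\<xi> i * \<xi> j))"
        using a(1)[unfolded elliptic_def, rule_format, of x] by (simp add: x_def mult.assoc)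
      also have "\<dots> = (\<Sum>i\<in>UNIV. \<Sum>j\<in>UNIV. s i j * (\<xi> i * \<xi> j))"
        by (rule half[symmetric]) simp
      finally show ?thesis by (simp add: mult.assoc)
    qed
    show "(\<Sum>i\<in>UNIV. \<Sum>j\<in>UNIV. h i j * \<xi> i * \<xi> j) \<le> 0" for \<xi>
    proof -
      define x :: "real ^ 'n" where "x = (\<chi> i. \<xi> i)"
      have "H x = (\<Sum>i\<in>UNIV. \<xi> i *\<^sub>R H (axis i 1))"
      proof -
        have "x = (\<Sum>i\<in>UNIV. \<xi> i *\<^sub>R axis i 1)"
          using basis_expansion[of x] by (simp add: x_def scalar_mult_eq_scaleR)
        then show ?thesis by (metis (mono_tags, lifting) lin linear_cmul linear_sum sum.cong)
      qed
      then have "H x \<bullet> x = (\<Sum>j\<in>UNIV. \<Sum>i\<in>UNIV. h i j * \<xi> i * \<xi> j)"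
        by (simp add: inner_vec_def h_def x_def sum_distrib_left algebra_simps)
      also have "\<dots> = (\<Sum>i\<in>UNIV. \<Sum>j\<in>UNIV. h i j * \<xi> i * \<xi> j)"
        by (rule sum.swap)
      finally have "H x \<bullet> x = \<dots>" .
      then show ?thesis using neg[of x] by simp
    qed
  qed simp
  then show ?thesis unfolding tr half[OF hsym] .
qed

text \<open>
  The one-sided condition in time allows the maximum to lie on the final time of the domain.
\<close>

lemma parabolic_max_conditions:
  fixes u :: "real \<Rightarrow> real ^ 'n \<Rightarrow> real"
  assumes ut: "((\<lambda>s. u s x) has_real_derivative ut) (at t)"
    and du: "\<And>x. (u t has_derivative (\<lambda>h. g x \<bullet> h)) (at x)"
    and dg: "(g has_derivative H) (at x)"
    and loc: "open S" "x \<in> S" "\<And>y. y \<in> S \<Longrightarrow> u t y \<le> u t x"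
    and past: "r < t" "\<And>s. r < s \<Longrightarrow> s < t \<Longrightarrow> u s x \<le> u t x"
    and a: "elliptic \<eta> a" "\<eta> > 0"
  shows "ut \<ge> 0" "g x = 0" "tr_hess a H \<le> 0"
proof -
  show "g x = 0" using local_max_gradient_hessian(1)[OF du dg loc] by blast
  show "tr_hess a H \<le> 0"
    using local_max_gradient_hessian(2)[OF du dg loc] hessian_symmetric[OF du dg] tr_hess_nonpos[OF a]
      has_derivative_linear[OF dg] by blast
  show "ut \<ge> 0"
  proof (rule ccontr)
    assume "\<not> ut \<ge> 0"
    then obtain d where d: "d > 0" "\<And>h. h > 0 \<Longrightarrow> h < d \<Longrightarrow> u t x < u (t - h) x"
      using DERIV_neg_dec_left[OF ut] by auto
    define h where "h = min d (t - r) / 2"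
    have "h > 0" "h < d" "r < t - h" using d(1) past(1) by (auto simp: h_def min_def field_simps)
    then show False using d(2)[of h] past(2)[of "t - h"] by simp
  qed
qed

section \<open>Parabolic maximum principles\<close>

text \<open>The derivatives are explicit arguments, so that differences and products of functions
  can be differentiated by formula, without evaluating \<open>deriv\<close> or
  \<open>frechet_derivative\<close>.\<close>

definition parabolic_jet :: "(real \<Rightarrow> real ^ 'n \<Rightarrow> real) \<Rightarrow> (real \<Rightarrow> real ^ 'n \<Rightarrow> real) \<Rightarrow>
    (real \<Rightarrow> real ^ 'n \<Rightarrow> real ^ 'n) \<Rightarrow> (real \<Rightarrow> real ^ 'n \<Rightarrow> real ^ 'n \<Rightarrow> real ^ 'n) \<Rightarrow> bool" where
  "parabolic_jet w wt g H \<longleftrightarrow>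
     continuous_on UNIV (\<lambda>(t, x). w t x) \<and>
     (\<forall>t x. ((\<lambda>s. w s x) has_real_derivative wt t x) (at t)) \<and>
     (\<forall>t x. (w t has_derivative (\<lambda>h. g t x \<bullet> h)) (at x)) \<and>
     (\<forall>t x. (g t has_derivative H t x) (at x))"

lemma parabolic_jetD:
  assumes "parabolic_jet w wt g H"
  shows "continuous_on UNIV (\<lambda>(t, x). w t x)"
    and "((\<lambda>s. w s x) has_real_derivative wt t x) (at t)"
    and "(w t has_derivative (\<lambda>h. g t x \<bullet> h)) (at x)"
    and "(g t has_derivative H t x) (at x)"
  using assms by (auto simp: parabolic_jet_def)

lemma parabolic_jet_diff:
  assumes "parabolic_jet u ut g H" "parabolic_jet v vt k G"
  shows "parabolic_jet (\<lambda>t x. u t x - v t x) (\<lambda>t x. ut t x - vt t x) (\<lambda>t x. g t x - k t x)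
    (\<lambda>t x h. H t x h - G t x h)"
  unfolding parabolic_jet_def
proof (intro conjI allI)
  show "continuous_on UNIV (\<lambda>(t, x). u t x - v t x)"
    using continuous_on_diff[OF parabolic_jetD(1)[OF assms(1)] parabolic_jetD(1)[OF assms(2)]]
    by (simp add: case_prod_unfold)
  fix t x
  show "((\<lambda>s. u s x - v s x) has_real_derivative ut t x - vt t x) (at t)"
    by (intro DERIV_diff parabolic_jetD(2)[OF assms(1)] parabolic_jetD(2)[OF assms(2)])
  show "((\<lambda>x. u t x - v t x) has_derivative (\<lambda>h. (g t x - k t x) \<bullet> h)) (at x)"
    unfolding inner_diff_left
    by (intro has_derivative_diff parabolic_jetD(3)[OF assms(1)] parabolic_jetD(3)[OF assms(2)])
  show "((\<lambda>x. g t x - k t x) has_derivative (\<lambda>h. H t x h - G t x h)) (at x)"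
    by (intro has_derivative_diff parabolic_jetD(4)[OF assms(1)] parabolic_jetD(4)[OF assms(2)])
qed

lemma parabolic_jet_time_factor:
  fixes w :: "real \<Rightarrow> real ^ 'n \<Rightarrow> real"
  assumes w: "parabolic_jet w wt g H" and r: "\<And>t. (r has_real_derivative r' t) (at t)"
  shows "parabolic_jet (\<lambda>t x. r t * w t x) (\<lambda>t x. r t * wt t x + r' t * w t x) (\<lambda>t x. r t *\<^sub>R g t x)
    (\<lambda>t x h. r t *\<^sub>R H t x h)"
  unfolding parabolic_jet_def
proof (intro conjI allI)
  have "continuous_on UNIV r"
    using r by (meson DERIV_isCont continuous_at_imp_continuous_on)
  then have "continuous_on UNIV (\<lambda>p::real \<times> (real ^ 'n). r (fst p))"
    by (rule continuous_on_compose2) (auto intro: continuous_on_fst continuous_on_id)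
  from continuous_on_mult[OF this parabolic_jetD(1)[OF w]]
  show "continuous_on UNIV (\<lambda>(t, x). r t * w t x)"
    by (simp add: case_prod_unfold)
  fix t x
  show "((\<lambda>s. r s * w s x) has_real_derivative r t * wt t x + r' t * w t x) (at t)"
    by (rule derivative_eq_intros r parabolic_jetD(2)[OF w])+ (simp add: algebra_simps)
  show "((\<lambda>x. r t * w t x) has_derivative (\<lambda>h. (r t *\<^sub>R g t x) \<bullet> h)) (at x)"
    by (rule derivative_eq_intros parabolic_jetD(3)[OF w])+ (simp add: algebra_simps)
  show "((\<lambda>x. r t *\<^sub>R g t x) has_derivative (\<lambda>h. r t *\<^sub>R H t x h)) (at x)"
    by (intro has_derivative_scaleR_right parabolic_jetD(4)[OF w])
qed

text \<open>The bounds are uniform in \<open>x\<close> because the constants of penalty and barrier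
  are fixed before the location of a maximum is known.\<close>

definition admissible_coeffs ::
    "real \<Rightarrow> real \<Rightarrow> (real ^ 'n \<Rightarrow> real ^ 'n ^ 'n) \<Rightarrow> (real ^ 'n \<Rightarrow> real ^ 'n) \<Rightarrow> bool" where
  "admissible_coeffs \<eta> C a b \<longleftrightarrow> \<eta> > 0 \<and> C > 0 \<and> (\<forall>x. elliptic \<eta> (a x)) \<and>
     (\<forall>x v. norm (a x *v v) \<le> C * norm v) \<and> (\<forall>x. norm (b x) \<le> C)"

section \<open>Ellipticity estimates and a smooth weight of linear growth\<close>

lemma elliptic_inner: "elliptic \<eta> a \<Longrightarrow> \<eta> * (norm v)\<^sup>2 \<le> v \<bullet> (a *v v)"
  unfolding elliptic_def
  by (drule spec[of _ v]) (simp add: inner_vec_def matrix_vector_mult_def sum_distrib_left algebra_simps)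

lemma tr_hess_rank_one: "tr_hess a (\<lambda>v. (y \<bullet> v) *\<^sub>R z) = y \<bullet> (a *v z)"
  unfolding tr_hess_def inner_vec_def[of y "a *v z"]
  by (simp add: inner_axis matrix_vector_mult_scaleR)

lemma tr_hess_id_bound:
  fixes a :: "real ^ 'n ^ 'n"
  assumes "\<And>v. norm (a *v v) \<le> C * norm v"
  shows "\<bar>tr_hess a (\<lambda>v. v)\<bar> \<le> real CARD('n) * C"
proof -
  have "\<bar>tr_hess a (\<lambda>v. v)\<bar> \<le> (\<Sum>i\<in>(UNIV::'n set). \<bar>(a *v axis i 1) $ i\<bar>)"
    unfolding tr_hess_def by (rule sum_abs)
  also have "\<dots> \<le> (\<Sum>i\<in>(UNIV::'n set). C)"
  proof (rule sum_mono)
    fix i :: 'n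
    show "\<bar>(a *v axis i 1) $ i\<bar> \<le> C"
      using component_le_norm_cart[of "a *v axis i 1" i] assms[of "axis i 1"] by simp
  qed
  finally show ?thesis by simp
qed

text \<open>The Japanese bracket, a smooth substitute for the norm: it grows linearly, while its
  gradient and Hessian stay bounded.\<close>

definition japanese :: "real ^ 'n \<Rightarrow> real" where
  "japanese x = sqrt (1 + x \<bullet> x)"

lemma japanese_ge: "japanese x \<ge> 1" "norm x \<le> japanese x"
  unfolding japanese_def norm_eq_sqrt_inner by (auto intro!: real_sqrt_le_mono)

lemma japanese_jet:
  fixes T :: real
  shows "parabolic_jet (\<lambda>t x. japanese x + (T - t)) (\<lambda>t x. -1) (\<lambda>t x. (1 / japanese x) *\<^sub>R x)
    (\<lambda>t x v. (1 / japanese x) *\<^sub>R v - (1 / japanese x ^ 3) *\<^sub>R ((x \<bullet> v) *\<^sub>R x))"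
proof -
  have pos: "1 + x \<bullet> x > 0" for x :: "real ^ 'n" by (smt (verit) inner_ge_zero)
  have d: "(japanese has_derivative (\<lambda>h. ((1 / japanese x) *\<^sub>R x) \<bullet> h)) (at x)" for x :: "real ^ 'n"
    unfolding japanese_def using pos[of x]
    by (auto intro!: derivative_eq_intros simp: inner_commute field_simps)
  have dd: "((\<lambda>x. (1 / japanese x) *\<^sub>R x) has_derivative
      (\<lambda>v. (1 / japanese x) *\<^sub>R v - (1 / japanese x ^ 3) *\<^sub>R ((x \<bullet> v) *\<^sub>R x))) (at x)" for x :: "real ^ 'n"
  proof -
    have nz: "japanese x \<noteq> 0" using japanese_ge(1)[of x] by auto
    have "((\<lambda>x. x /\<^sub>R japanese x) has_derivative
      (\<lambda>v. (1 / japanese x) *\<^sub>R v - (1 / japanese x ^ 3) *\<^sub>R ((x \<bullet> v) *\<^sub>R x))) (at x)"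
      by (rule has_derivative_eq_rhs[OF has_derivative_scaleR[OF Deriv.has_derivative_inverse[OF nz d]
          has_derivative_ident]])
        (simp add: fun_eq_iff power3_eq_cube divide_inverse mult_ac)
    then show ?thesis unfolding inverse_eq_divide .
  qed
  show ?thesis
    unfolding parabolic_jet_def
  proof (intro conjI allI)
    show "continuous_on UNIV (\<lambda>(t::real, x::real ^ 'n). japanese x + (T - t))"
      unfolding japanese_def case_prod_unfold by (intro continuous_intros)
    fix t :: real and x :: "real ^ 'n"
    show "((\<lambda>s. japanese x + (T - s)) has_real_derivative - 1) (at t)"
      by (auto intro!: derivative_eq_intros)
    show "((\<lambda>x. japanese x + (T - t)) has_derivative (\<lambda>h. ((1 / japanese x) *\<^sub>R x) \<bullet> h)) (at x)"
      using has_derivative_add[OF d has_derivative_const[of "T - t"]] by simp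
  qed (rule dd)
qed

lemma japanese_operator_bound:
  fixes a :: "real ^ 'n \<Rightarrow> real ^ 'n ^ 'n"
  assumes "admissible_coeffs \<eta> C a b"
  shows "tr_hess (a x) (\<lambda>v. (1 / japanese x) *\<^sub>R v - (1 / japanese x ^ 3) *\<^sub>R ((x \<bullet> v) *\<^sub>R x))
    + b x \<bullet> ((1 / japanese x) *\<^sub>R x) \<le> real CARD('n) * C + C"
proof -
  define J where "J = japanese x"
  have J: "J \<ge> 1" "norm x \<le> J" using japanese_ge[of x] by (auto simp: J_def)
  have co: "C > 0" "\<eta> > 0" "norm (b x) \<le> C" "\<And>v. norm (a x *v v) \<le> C * norm v" "elliptic \<eta> (a x)"
    using assms by (auto simp: admissible_coeffs_def)
  have "tr_hess (a x) (\<lambda>v. (1 / J) *\<^sub>R v - (1 / J ^ 3) *\<^sub>R ((x \<bullet> v) *\<^sub>R x))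
      = (1 / J) * tr_hess (a x) (\<lambda>v. v) - (1 / J ^ 3) * (x \<bullet> (a x *v x))"
    by (simp only: tr_hess_diff tr_hess_scale tr_hess_rank_one)
  moreover have "(1 / J ^ 3) * (x \<bullet> (a x *v x)) \<ge> 0"
  proof -
    have "0 \<le> \<eta> * (norm x)\<^sup>2" using co(2) by simp
    also have "\<dots> \<le> x \<bullet> (a x *v x)" by (rule elliptic_inner[OF co(5)])
    finally show ?thesis using J by simp
  qed
  moreover have "(1 / J) * tr_hess (a x) (\<lambda>v. v) \<le> real CARD('n) * C"
  proof -
    have "(1 / J) * tr_hess (a x) (\<lambda>v. v) \<le> (1 / J) * (real CARD('n) * C)"
      using tr_hess_id_bound[of "a x" C] co(4) J by (intro mult_left_mono) auto
    also have "\<dots> \<le> 1 * (real CARD('n) * C)"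
      using J co(1) by (intro mult_right_mono) auto
    finally show ?thesis by simp
  qed
  moreover have "b x \<bullet> ((1 / J) *\<^sub>R x) \<le> C"
  proof -
    have "b x \<bullet> ((1 / J) *\<^sub>R x) \<le> norm (b x) * norm ((1 / J) *\<^sub>R x)" by (rule norm_cauchy_schwarz)
    also have "\<dots> \<le> C * 1"
      using J co by (intro mult_mono) auto
    finally show ?thesis by simp
  qed
  ultimately show ?thesis unfolding J_def by linarith
qed

text \<open>
  Subtracting \<open>\<epsilon> (japanese x + T - t)\<close> makes the supremum over the ancient unbounded domain a
  maximum.
\<close>

lemma ancient_max_principle:
  fixes w :: "real \<Rightarrow> real ^ 'n \<Rightarrow> real"
  assumes jet: "parabolic_jet w wt g H" and co: "admissible_coeffs \<eta> C a b" and "\<gamma> > 0"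
    and bd: "\<And>t x. t \<le> T \<Longrightarrow> w t x \<le> M"
    and ineq: "\<And>t x. t \<le> T \<Longrightarrow> w t x > 0 \<Longrightarrow>
      wt t x \<le> tr_hess (a x) (H t x) + b x \<bullet> g t x - \<gamma> * w t x"
    and "t1 \<le> T"
  shows "w t1 x1 \<le> 0"
proof (rule ccontr)
  assume "\<not> w t1 x1 \<le> 0"
  define m where "m = w t1 x1"
  have m: "m > 0" using \<open>\<not> w t1 x1 \<le> 0\<close> by (simp add: m_def)
  define Q where "Q = (\<lambda>t x. japanese (x::real ^ 'n) + (T - t))"
  \<comment> \<open>The bound on the spatial operator applied to the weight, plus 1 for its time
    derivative.\<close>
  define K where "K = real CARD('n) * C + C + 1"
  have K: "K > 0" using co by (auto simp: K_def admissible_coeffs_def intro!: add_nonneg_pos)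
  have Q1: "Q t1 x1 > 0" using japanese_ge(1)[of x1] \<open>t1 \<le> T\<close> by (simp add: Q_def)
  \<comment> \<open>The first bound keeps the penalized function at least m / 2 at the given point.
    The second makes the total effect of the penalty at most \<gamma> m / 4, whereas the absorption
    at the maximum is at least \<gamma> m / 2.\<close>
  define \<epsilon> where "\<epsilon> = min (m / (2 * Q t1 x1)) (\<gamma> * m / (4 * K))"
  have e: "\<epsilon> > 0" "\<epsilon> * Q t1 x1 \<le> m / 2" "\<epsilon> * K \<le> \<gamma> * m / 4"
  proof -
    show "\<epsilon> > 0" using m K Q1 \<open>\<gamma> > 0\<close> by (simp add: \<epsilon>_def)
    have "\<epsilon> * Q t1 x1 \<le> m / (2 * Q t1 x1) * Q t1 x1" using Q1 by (intro mult_right_mono) (auto simp: \<epsilon>_def)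
    then show "\<epsilon> * Q t1 x1 \<le> m / 2" using Q1 by simp
    have "\<epsilon> * K \<le> \<gamma> * m / (4 * K) * K" using K by (intro mult_right_mono) (auto simp: \<epsilon>_def)
    then show "\<epsilon> * K \<le> \<gamma> * m / 4" using K by simp
  qed
  define v where "v = (\<lambda>t x. w t x - \<epsilon> * Q t x)"
  \<comment> \<open>The summand with factor 0 is the time derivative of the constant factor
    \<epsilon>.\<close>
  have jv: "parabolic_jet v (\<lambda>t x. wt t x - (\<epsilon> * (-1) + 0 * Q t x))
      (\<lambda>t x. g t x - \<epsilon> *\<^sub>R ((1 / japanese x) *\<^sub>R x))
      (\<lambda>t x h. H t x h - \<epsilon> *\<^sub>R ((1 / japanese x) *\<^sub>R h - (1 / japanese x ^ 3) *\<^sub>R ((x \<bullet> h) *\<^sub>R x)))"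
    unfolding v_def Q_def
    by (intro parabolic_jet_diff[OF jet] parabolic_jet_time_factor[OF japanese_jet]) simp
  \<comment> \<open>On this superlevel set \<epsilon> Q is at most \<open>M\<close>, and Q dominates
    both the norm of \<open>x\<close> and \<open>T - t\<close>; hence the set is compact.\<close>
  define S where "S = {p. fst p \<le> T \<and> m / 2 \<le> v (fst p) (snd p)}"
  have contv: "continuous_on UNIV (\<lambda>p. v (fst p) (snd p))"
    using parabolic_jetD(1)[OF jv] by (simp add: case_prod_unfold)
  have "closed S"
    unfolding S_def by (intro closed_Collect_conj closed_Collect_le contv continuous_intros)
  moreover have "bounded S"
  proof (rule bounded_subset)
    show "bounded ({T - M / \<epsilon>..T} \<times> cball (0::real ^ 'n) (M / \<epsilon>))"
      by (intro bounded_Times) auto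
    show "S \<subseteq> {T - M / \<epsilon>..T} \<times> cball 0 (M / \<epsilon>)"
    proof
      fix p assume "p \<in> S"
      then obtain t x where p: "p = (t, x)" "t \<le> T" "m / 2 \<le> v t x" by (cases p) (auto simp: S_def)
      have "\<epsilon> * Q t x \<le> M" using bd[OF p(2), of x] p(3) m by (simp add: v_def)
      then have "Q t x \<le> M / \<epsilon>" using e(1) by (simp add: field_simps)
      then show "p \<in> {T - M / \<epsilon>..T} \<times> cball 0 (M / \<epsilon>)"
        using japanese_ge[of x] p(1,2) by (simp add: Q_def)
    qed
  qed
  ultimately have "compact S" using compact_eq_bounded_closed by blast
  moreover have in1: "(t1, x1) \<in> S" using e(2) \<open>t1 \<le> T\<close> by (simp add: S_def v_def m_def)
  ultimately obtain p where p: "p \<in> S" "\<And>q. q \<in> S \<Longrightarrow> v (fst q) (snd q) \<le> v (fst p) (snd p)"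
    using continuous_attains_sup[of S "\<lambda>p. v (fst p) (snd p)"] contv continuous_on_subset by blast
  define t0 x0 where "t0 = fst p" and "x0 = snd p"
  have t0: "t0 \<le> T" "m / 2 \<le> v t0 x0" using p(1) by (auto simp: S_def t0_def x0_def)
  have max: "v t x \<le> v t0 x0" if "t \<le> T" for t x
    using p(2)[of "(t, x)"] that t0(2) by (force simp: S_def t0_def x0_def)
  have wpos: "w t0 x0 \<ge> m / 2"
  proof -
    have "\<epsilon> * Q t0 x0 \<ge> 0" using e(1) t0(1) japanese_ge(1)[of x0] by (simp add: Q_def)
    then show ?thesis using t0(2) by (simp add: v_def)
  qed
  have el: "elliptic \<eta> (a x0)" "\<eta> > 0" using co by (auto simp: admissible_coeffs_def)
  define D where "D = (\<lambda>h. (1 / japanese x0) *\<^sub>R h - (1 / japanese x0 ^ 3) *\<^sub>R ((x0 \<bullet> h) *\<^sub>R x0))"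
  define d where "d = (1 / japanese x0) *\<^sub>R x0"
  \<comment> \<open>The maximum is taken over all of space and all earlier times, so
    \<open>UNIV\<close> serves as the neighbourhood and \<open>t0 - 1\<close> as the earlier
    time.\<close>
  note mc = parabolic_max_conditions[OF parabolic_jetD(2-4)[OF jv], of UNIV x0 t0 "t0 - 1", OF _ _ _ _ _ el]
  have c1: "wt t0 x0 + \<epsilon> \<ge> 0" using mc(1) max t0(1) by simp
  have c2: "g t0 x0 = \<epsilon> *\<^sub>R d" using mc(2) max t0(1) by (simp add: d_def)
  have c3: "tr_hess (a x0) (H t0 x0) \<le> \<epsilon> * tr_hess (a x0) D"
  proof -
    have "tr_hess (a x0) (\<lambda>h. H t0 x0 h - \<epsilon> *\<^sub>R D h) \<le> 0"
      unfolding D_def using mc(3) max t0(1) by simp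
    then show ?thesis by (simp only: tr_hess_diff tr_hess_scale)
  qed
  have "- \<epsilon> \<le> wt t0 x0" using c1 by simp
  also have "\<dots> \<le> tr_hess (a x0) (H t0 x0) + b x0 \<bullet> g t0 x0 - \<gamma> * w t0 x0"
    using ineq[OF t0(1)] wpos m by simp
  also have "\<dots> \<le> \<epsilon> * (tr_hess (a x0) D + b x0 \<bullet> d) - \<gamma> * w t0 x0"
    using c3 by (simp add: c2 algebra_simps)
  also have "\<dots> \<le> \<epsilon> * (K - 1) - \<gamma> * (m / 2)"
    using japanese_operator_bound[OF co, of x0] e(1) wpos \<open>\<gamma> > 0\<close>
    by (intro diff_mono mult_left_mono) (auto simp: D_def d_def K_def)
  finally have "\<gamma> * m / 2 \<le> \<epsilon> * K" by (simp add: algebra_simps)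
  moreover have "\<gamma> * m > 0" using m \<open>\<gamma> > 0\<close> by simp
  ultimately show False using e(3) by simp
qed

text \<open>Here \<open>y\<close> is the position relative to a centre moving with velocity
  \<open>q\<close>. Squaring \<open>h\<close> produces the Hessian term 8 y (y . v), which stays
  positive in the operator near the rim where \<open>h\<close> vanishes; farther inside, the
  exponential decay makes the barrier a subsolution.\<close>

lemma barrier_jet:
  fixes q x1 :: "real ^ 'n" and t1 r \<epsilon> \<kappa> :: real
  defines "y \<equiv> \<lambda>t x. x - x1 - (t - t1) *\<^sub>R q"
  defines "h \<equiv> \<lambda>t x. r\<^sup>2 - y t x \<bullet> y t x"
  defines "E \<equiv> \<lambda>t. \<epsilon> * exp (- \<kappa> * (t - t1))"
  shows "parabolic_jet (\<lambda>t x. E t * (h t x)\<^sup>2)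
    (\<lambda>t x. E t * (4 * h t x * (y t x \<bullet> q)) + (- \<kappa> * E t) * (h t x)\<^sup>2)
    (\<lambda>t x. E t *\<^sub>R ((- 4 * h t x) *\<^sub>R y t x))
    (\<lambda>t x v. E t *\<^sub>R (8 *\<^sub>R ((y t x \<bullet> v) *\<^sub>R y t x) - (4 * h t x) *\<^sub>R v))"
proof (rule parabolic_jet_time_factor)
  show "(E has_real_derivative - \<kappa> * E t) (at t)" for t
    unfolding E_def by (auto intro!: derivative_eq_intros)
  show "parabolic_jet (\<lambda>t x. (h t x)\<^sup>2) (\<lambda>t x. 4 * h t x * (y t x \<bullet> q))
    (\<lambda>t x. (- 4 * h t x) *\<^sub>R y t x) (\<lambda>t x v. 8 *\<^sub>R ((y t x \<bullet> v) *\<^sub>R y t x) - (4 * h t x) *\<^sub>R v)"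
    unfolding parabolic_jet_def
  proof (intro conjI allI)
    show "continuous_on UNIV (\<lambda>(t, x). (h t x)\<^sup>2)"
      unfolding h_def y_def case_prod_unfold by (intro continuous_intros)
    fix t x
    have yt: "((\<lambda>s. y s x) has_derivative (\<lambda>s. - s *\<^sub>R q)) (at t)"
      unfolding y_def by (auto intro!: derivative_eq_intros)
    have "((\<lambda>s. (h s x)\<^sup>2) has_derivative (\<lambda>s. 4 * h t x * (y t x \<bullet> q) * s)) (at t)"
      unfolding h_def by (auto intro!: derivative_eq_intros yt simp: inner_commute algebra_simps)
    then show "((\<lambda>s. (h s x)\<^sup>2) has_real_derivative 4 * h t x * (y t x \<bullet> q)) (at t)"
      unfolding has_field_derivative_def .
    have yx: "(y t has_derivative (\<lambda>v. v)) (at x)"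
      unfolding y_def by (auto intro!: derivative_eq_intros)
    have hx: "(h t has_derivative (\<lambda>v. - 2 * (y t x \<bullet> v))) (at x)"
      unfolding h_def by (auto intro!: derivative_eq_intros yx simp: inner_commute)
    show "((\<lambda>x. (h t x)\<^sup>2) has_derivative (\<lambda>v. ((- 4 * h t x) *\<^sub>R y t x) \<bullet> v)) (at x)"
      by (auto intro!: derivative_eq_intros hx)
    show "((\<lambda>x. (- 4 * h t x) *\<^sub>R y t x) has_derivative
        (\<lambda>v. 8 *\<^sub>R ((y t x \<bullet> v) *\<^sub>R y t x) - (4 * h t x) *\<^sub>R v)) (at x)"
      by (auto intro!: derivative_eq_intros hx yx)
  qed
qed

text \<open>
  The barrier is compared with \<open>z\<close> on a ball that moves from \<open>x1\<close> at time \<open>t1\<close> to \<open>x0\<close> at time \<open>t0\<close>; the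
  decay rate \<open>\<kappa>\<close> makes the quadratic polynomial in \<open>h\<close> that measures its failure to be a subsolution
  free of real roots.
\<close>

lemma strong_max_principle:
  fixes z :: "real \<Rightarrow> real ^ 'n \<Rightarrow> real"
  assumes jet: "parabolic_jet z zt g H" and co: "admissible_coeffs \<eta> C a b"
    and nonneg: "\<And>t x. z t x \<ge> 0"
    and ineq: "\<And>t x. zt t x \<ge> tr_hess (a x) (H t x) + b x \<bullet> g t x - K * z t x"
    and "K \<ge> 0" and "t1 < t0" and pos: "z t1 x1 > 0"
  shows "z t0 x0 > 0"
proof -
  have c: "C > 0" "\<eta> > 0" "\<And>x. elliptic \<eta> (a x)" "\<And>x. norm (b x) \<le> C"
    "\<And>x v. norm (a x *v v) \<le> C * norm v"
    using co by (auto simp: admissible_coeffs_def)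
  have contz: "continuous_on UNIV (\<lambda>p. z (fst p) (snd p))"
    using parabolic_jetD(1)[OF jet] by (simp add: case_prod_unfold)
  have "continuous_on UNIV (z t1)"
    using parabolic_jetD(3)[OF jet] by (meson continuous_at_imp_continuous_on has_derivative_continuous)
  then have "isCont (z t1) x1" by (simp add: continuous_on_eq_continuous_at)
  then have "(z t1 \<longlongrightarrow> z t1 x1) (nhds x1)"
    by (simp add: isCont_def tendsto_at_iff_tendsto_nhds)
  from order_tendstoD(1)[OF this, of "z t1 x1 / 2"]
  have "\<forall>\<^sub>F x in nhds x1. z t1 x > z t1 x1 / 2"
    using pos by simp
  then obtain r' where r': "r' > 0" "\<And>x. dist x x1 < r' \<Longrightarrow> z t1 x > z t1 x1 / 2"
    unfolding eventually_nhds_metric by auto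
  define r where "r = r' / 2"
  have r: "r > 0" "\<And>x. norm (x - x1) \<le> r \<Longrightarrow> z t1 x > z t1 x1 / 2"
    using r' by (auto simp: r_def dist_norm)
  \<comment> \<open>The barrier is at most \<epsilon> times the fourth power of \<open>r\<close> at
    time \<open>t1\<close>, which is half of \<open>z t1 x1\<close> and thus below \<open>z\<close>
    on the initial ball.\<close>
  define \<epsilon> where "\<epsilon> = z t1 x1 / (2 * r ^ 4)"
  have e: "\<epsilon> > 0" "\<epsilon> * r ^ 4 = z t1 x1 / 2" using pos r by (auto simp: \<epsilon>_def)
  define q where "q = (1 / (t0 - t1)) *\<^sub>R (x0 - x1)"
  \<comment> \<open>\<open>C1\<close> collects the coefficients of terms linear in \<open>h\<close>:
    replacing the squared norm of \<open>y\<close> by \<open>r\<^sup>2 - h\<close> in the elliptic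
    term, then the trace, the drift, and the motion of the ball. \<open>D\<close> is what remains at
    the rim.\<close>
  define C1 where "C1 = 8 * \<eta> + 4 * (real CARD('n) * C) + 4 * C * r + 4 * r * norm q"
  define D where "D = 8 * \<eta> * r\<^sup>2"
  have D: "D > 0" using c r by (simp add: D_def)
  define \<kappa> where "\<kappa> = K + C1\<^sup>2 / D"
  define y where "y = (\<lambda>t x. x - x1 - (t - t1) *\<^sub>R q)"
  define h where "h = (\<lambda>t x. r\<^sup>2 - y t x \<bullet> y t x)"
  define E where "E = (\<lambda>t. \<epsilon> * exp (- \<kappa> * (t - t1)))"
  have Epos: "E t > 0" for t using e by (simp add: E_def)
  define \<psi> where "\<psi> = (\<lambda>t x. E t * (h t x)\<^sup>2)"
  define v where "v = (\<lambda>t x. \<psi> t x - z t x)"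
  define vt where "vt = (\<lambda>t x. E t * (4 * h t x * (y t x \<bullet> q)) + (- \<kappa> * E t) * (h t x)\<^sup>2 - zt t x)"
  define gv where "gv = (\<lambda>t x. E t *\<^sub>R ((- 4 * h t x) *\<^sub>R y t x) - g t x)"
  define Hv where "Hv = (\<lambda>t x w. E t *\<^sub>R (8 *\<^sub>R ((y t x \<bullet> w) *\<^sub>R y t x) - (4 * h t x) *\<^sub>R w) - H t x w)"
  have jv: "parabolic_jet v vt gv Hv"
    unfolding v_def \<psi>_def h_def y_def E_def vt_def gv_def Hv_def
    by (intro parabolic_jet_diff[OF _ jet] barrier_jet)
  have contv: "continuous_on UNIV (\<lambda>p. v (fst p) (snd p))"
    using parabolic_jetD(1)[OF jv] by (simp add: case_prod_unfold)
  define S where "S = {p. fst p \<in> {t1..t0} \<and> norm (y (fst p) (snd p)) \<le> r}"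
  have conty: "continuous_on UNIV (\<lambda>p. y (fst p) (snd p))"
    unfolding y_def by (intro continuous_intros)
  have "closed S"
    unfolding S_def atLeastAtMost_iff
    by (intro closed_Collect_conj closed_Collect_le continuous_intros conty)
  moreover have "bounded S"
  proof (rule bounded_subset)
    define R where "R = r + norm x1 + (t0 - t1) * norm q"
    show "bounded ({t1..t0} \<times> cball (0::real ^ 'n) R)"
      by (intro bounded_Times) auto
    show "S \<subseteq> {t1..t0} \<times> cball 0 R"
    proof
      fix p assume "p \<in> S"
      then obtain t x where p: "p = (t, x)" "t \<in> {t1..t0}" "norm (y t x) \<le> r"
        by (cases p) (auto simp: S_def)
      have "norm x = norm (y t x + x1 + (t - t1) *\<^sub>R q)" by (simp add: y_def)
      also have "\<dots> \<le> norm (y t x) + norm x1 + norm ((t - t1) *\<^sub>R q)"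
        by (intro order_trans[OF norm_triangle_ineq] add_mono norm_triangle_ineq order_refl)
      also have "\<dots> \<le> R"
        unfolding R_def using p by (intro add_mono) (auto intro!: mult_right_mono)
      finally show "p \<in> {t1..t0} \<times> cball 0 R" using p by simp
    qed
  qed
  ultimately have "compact S" using compact_eq_bounded_closed by blast
  moreover have yt0: "y t0 x0 = 0" using \<open>t1 < t0\<close> by (simp add: y_def q_def)
  then have in0: "(t0, x0) \<in> S" using \<open>t1 < t0\<close> r by (simp add: S_def)
  ultimately obtain p where p: "p \<in> S" "\<And>q. q \<in> S \<Longrightarrow> v (fst q) (snd q) \<le> v (fst p) (snd p)"
    using continuous_attains_sup[of S "\<lambda>p. v (fst p) (snd p)"] contv continuous_on_subset by blast
  define s x where "s = fst p" and "x = snd p"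
  have s: "t1 \<le> s" "s \<le> t0" "norm (y s x) \<le> r" using p(1) by (auto simp: S_def s_def x_def)
  have max: "v s' x' \<le> v s x" if "t1 \<le> s'" "s' \<le> t0" "norm (y s' x') \<le> r" for s' x'
    using p(2)[of "(s', x')"] that by (simp add: S_def s_def x_def)
  have "v s x \<le> 0"
  proof (rule ccontr)
    assume "\<not> v s x \<le> 0"
    then have vpos: "\<psi> s x > z s x" by (simp add: v_def)
    \<comment> \<open>A positive maximum cannot lie on the lateral boundary, where the barrier
      vanishes and \<open>z\<close> is nonnegative.\<close>
    then have hnz: "h s x \<noteq> 0" using nonneg[of s x] by (auto simp: \<psi>_def)
    have hy: "h s x = r\<^sup>2 - (norm (y s x))\<^sup>2" by (simp add: h_def power2_norm_eq_inner)
    have "(norm (y s x))\<^sup>2 \<le> r\<^sup>2" using s(3) by (simp add: power_mono)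
    then have hpos: "h s x > 0" using hnz hy by simp
    then have inner: "norm (y s x) < r"
      using s(3) hy by (cases "norm (y s x) = r") auto
    have "h s x \<le> r\<^sup>2" unfolding hy by simp
    have "t1 \<noteq> s"
    proof
      assume "t1 = s"
      have "(h s x)\<^sup>2 \<le> (r\<^sup>2)\<^sup>2" using hpos \<open>h s x \<le> r\<^sup>2\<close> by (intro power_mono) auto
      then have "\<psi> s x \<le> \<epsilon> * (r\<^sup>2)\<^sup>2"
        using \<open>t1 = s\<close> e(1) by (simp add: \<psi>_def E_def)
      also have "\<dots> = z t1 x1 / 2" using e(2) by simp
      also have "\<dots> < z s x" using r(2)[of x] s(3) \<open>t1 = s\<close> by (simp add: y_def)
      finally show False using vpos by simp
    qed
    then have "t1 < s" using s(1) by simp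
    have opn: "open {x'. norm (y s x') < r}"
      unfolding y_def by (intro open_Collect_less continuous_intros)
    have "open {t. norm (y t x) < r}"
      unfolding y_def by (intro open_Collect_less continuous_intros)
    then obtain d where d: "d > 0" "\<And>t. dist t s < d \<Longrightarrow> norm (y t x) < r"
      using inner unfolding open_dist by auto
    define \<rho> where "\<rho> = max t1 (s - d)"
    have past: "\<rho> < s" "\<And>t. \<rho> < t \<Longrightarrow> t < s \<Longrightarrow> v t x \<le> v s x"
    proof -
      show "\<rho> < s" using \<open>t1 < s\<close> d(1) by (simp add: \<rho>_def)
      fix t assume "\<rho> < t" "t < s"
      then have "norm (y t x) < r" by (intro d(2)) (auto simp: \<rho>_def dist_real_def)
      then show "v t x \<le> v s x"
        using \<open>\<rho> < t\<close> \<open>t < s\<close> s(2) by (intro max) (auto simp: \<rho>_def)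
    qed
    note mc = parabolic_max_conditions[OF parabolic_jetD(2-4)[OF jv] opn _ _ past c(3)[of x] c(2)]
    have loc: "x \<in> {x'. norm (y s x') < r}" "\<And>y'. y' \<in> {x'. norm (y s x') < r} \<Longrightarrow> v s y' \<le> v s x"
      using inner max s by auto
    define Y where "Y = y s x"
    define h0 where "h0 = h s x"
    have h0: "h0 > 0" "(norm Y)\<^sup>2 = r\<^sup>2 - h0" "norm Y \<le> r"
      using hpos hy inner by (auto simp: h0_def Y_def)
    have 1: "zt s x \<le> E s * (4 * h0 * (Y \<bullet> q)) - \<kappa> * E s * h0\<^sup>2"
      using mc(1)[OF loc] by (simp add: vt_def h0_def Y_def)
    have 2: "g s x = E s *\<^sub>R ((- 4 * h0) *\<^sub>R Y)"
      using mc(2)[OF loc] by (simp add: gv_def h0_def Y_def)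
    have 3: "E s * (8 * (Y \<bullet> (a x *v Y)) - 4 * h0 * tr_hess (a x) (\<lambda>w. w)) \<le> tr_hess (a x) (H s x)"
      using mc(3)[OF loc] by (simp only: Hv_def tr_hess_diff tr_hess_scale tr_hess_rank_one h0_def Y_def) simp
    \<comment> \<open>Where the barrier exceeds \<open>z\<close>, it also bounds the zero-order
      term, so that the inequality involves the barrier alone and can be divided by
      \<open>E s\<close>.\<close>
    have "K * z s x \<le> K * (E s * h0\<^sup>2)"
      using vpos \<open>K \<ge> 0\<close> by (intro mult_left_mono) (auto simp: \<psi>_def h0_def)
    then have "E s * (8 * (Y \<bullet> (a x *v Y)) - 4 * h0 * tr_hess (a x) (\<lambda>w. w)) + b x \<bullet> g s x - K * (E s * h0\<^sup>2)
      \<le> E s * (4 * h0 * (Y \<bullet> q)) - \<kappa> * E s * h0\<^sup>2"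
      using 1 3 ineq[of x s] by linarith
    then have "E s * (8 * (Y \<bullet> (a x *v Y)) - 4 * h0 * tr_hess (a x) (\<lambda>w. w) - 4 * h0 * (b x \<bullet> Y) - K * h0\<^sup>2)
      \<le> E s * (4 * h0 * (Y \<bullet> q) - \<kappa> * h0\<^sup>2)"
      unfolding 2 by (simp add: algebra_simps)
    then have ineq': "8 * (Y \<bullet> (a x *v Y)) - 4 * h0 * tr_hess (a x) (\<lambda>w. w) - 4 * h0 * (b x \<bullet> Y) - K * h0\<^sup>2
      \<le> 4 * h0 * (Y \<bullet> q) - \<kappa> * h0\<^sup>2"
      using Epos[of s] by (simp only: mult_le_cancel_left_pos)
    have b1: "\<eta> * (r\<^sup>2 - h0) \<le> Y \<bullet> (a x *v Y)" using elliptic_inner[OF c(3), of Y x] h0(2) by simp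
    have b2: "h0 * tr_hess (a x) (\<lambda>w. w) \<le> h0 * (real CARD('n) * C)"
      using tr_hess_id_bound[OF c(5), of x] h0 by (intro mult_left_mono) auto
    have b3: "h0 * (b x \<bullet> Y) \<le> h0 * (C * r)"
    proof (rule mult_left_mono)
      show "b x \<bullet> Y \<le> C * r"
        by (rule order_trans[OF norm_cauchy_schwarz mult_mono]) (use c h0 in auto)
    qed (use h0 in simp)
    have b4: "h0 * (Y \<bullet> q) \<le> h0 * (r * norm q)"
    proof (rule mult_left_mono)
      show "Y \<bullet> q \<le> r * norm q"
        by (rule order_trans[OF norm_cauchy_schwarz mult_right_mono]) (use h0 in auto)
    qed (use h0 in simp)
    have "D - C1 * h0 + (\<kappa> - K) * h0\<^sup>2 \<le> 0"
      using ineq' b1 b2 b3 b4 by (simp add: D_def C1_def algebra_simps)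
    then have "D - C1 * h0 + (C1\<^sup>2 / D) * h0\<^sup>2 \<le> 0" by (simp add: \<kappa>_def)
    then have "D * (D - C1 * h0 + (C1\<^sup>2 / D) * h0\<^sup>2) \<le> 0"
      using D by (simp add: mult_nonneg_nonpos)
    then have "D\<^sup>2 - D * (C1 * h0) + (C1 * h0)\<^sup>2 \<le> 0"
      using D by (simp add: algebra_simps power2_eq_square)
    moreover have "D\<^sup>2 - D * (C1 * h0) + (C1 * h0)\<^sup>2 = (D / 2 - C1 * h0)\<^sup>2 + 3 / 4 * D\<^sup>2"
      by (simp add: power2_eq_square field_simps)
    moreover have "3 / 4 * D\<^sup>2 > 0" using D by simp
    ultimately show False using zero_le_power2[of "D / 2 - C1 * h0"] by linarith
  qed
  then have "\<psi> t0 x0 \<le> z t0 x0"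
    using max[of t0 x0] yt0 r \<open>t1 < t0\<close> by (simp add: v_def)
  moreover have "\<psi> t0 x0 > 0" using Epos r yt0 by (simp add: \<psi>_def h_def)
  ultimately show ?thesis by simp
qed

section \<open>Comparison and sliding of fronts\<close>

lemma periodic_reduce:
  fixes x :: "real ^ 'n"
  obtains k where "\<And>i. k $ i \<in> \<int>" "x - k \<in> cbox 0 (\<chi> i. 1)"
proof
  show "(\<chi> i. real_of_int \<lfloor>x $ i\<rfloor>) $ j \<in> \<int>" for j :: 'n by simp
  show "x - (\<chi> i. real_of_int \<lfloor>x $ i\<rfloor>) \<in> cbox 0 (\<chi> i. 1)"
    by (auto simp: mem_box_cart intro: less_imp_le floor_correct) linarith+
qed

lemma periodic_shift:
  assumes "periodic g" "\<And>i. k $ i \<in> \<int>"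
  shows "g (x + k) = g x" "g (x - k) = g x"
proof -
  show *: "g (x + k) = g x" for x using assms unfolding periodic_def by blast
  show "g (x - k) = g x" using *[of "x - k"] by simp
qed

text \<open>The equation at one fixed scale. Stability is stated for differences, since it is
  applied to the values of two solutions at the same point.\<close>

locale bistable_equation =
  fixes \<eta> C :: real and a :: "real ^ 'n \<Rightarrow> real ^ 'n ^ 'n" and b :: "real ^ 'n \<Rightarrow> real ^ 'n"
    and F :: "real ^ 'n \<Rightarrow> real \<Rightarrow> real" and K \<gamma> \<delta> :: real
  assumes coeffs: "admissible_coeffs \<eta> C a b"
    and K_nonneg: "K \<ge> 0" and \<gamma>_pos: "\<gamma> > 0" and \<delta>_pos: "\<delta> > 0"
    and F_lipschitz: "\<And>x u v. u \<in> {0..1} \<Longrightarrow> v \<in> {0..1} \<Longrightarrow> \<bar>F x u - F x v\<bar> \<le> K * \<bar>u - v\<bar>"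
    and F_stable_0: "\<And>x u v. 0 \<le> v \<Longrightarrow> v \<le> u \<Longrightarrow> u \<le> \<delta> \<Longrightarrow> F x u - F x v \<le> - \<gamma> * (u - v)"
    and F_stable_1: "\<And>x u v. 1 - \<delta> \<le> v \<Longrightarrow> v \<le> u \<Longrightarrow> u \<le> 1 \<Longrightarrow> F x u - F x v \<le> - \<gamma> * (u - v)"
begin

definition solution :: "(real \<Rightarrow> real ^ 'n \<Rightarrow> real) \<Rightarrow> bool" where
  "solution U \<longleftrightarrow> (\<exists>Ut g H. parabolic_jet U Ut g H \<and>
     (\<forall>t x. Ut t x = tr_hess (a x) (H t x) + b x \<bullet> g t x + F x (U t x)))"

section \<open>Comparison of two solutions\<close>

lemma solution_diff:
  assumes "solution U" "solution V"
  obtains wt g H where "parabolic_jet (\<lambda>t x. U t x - V t x) wt g H"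
    "\<And>t x. wt t x = tr_hess (a x) (H t x) + b x \<bullet> g t x + (F x (U t x) - F x (V t x))"
proof -
  obtain Ut g H where U: "parabolic_jet U Ut g H"
    "\<And>t x. Ut t x = tr_hess (a x) (H t x) + b x \<bullet> g t x + F x (U t x)"
    using assms(1) unfolding solution_def by blast
  obtain Vt k G where V: "parabolic_jet V Vt k G"
    "\<And>t x. Vt t x = tr_hess (a x) (G t x) + b x \<bullet> k t x + F x (V t x)"
    using assms(2) unfolding solution_def by blast
  show ?thesis
    by (rule that[OF parabolic_jet_diff[OF U(1) V(1)]])
      (simp add: U(2) V(2) tr_hess_diff inner_diff_right)
qed

text \<open>Where U exceeds V, the alternative puts both values into the same stable zone: the bound
  \<delta> passes from U down to V, and 1 - \<delta> passes from V up to U. There the reaction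
  supplies the absorption that \<open>ancient_max_principle\<close> requires.\<close>

lemma stable_comparison:
  assumes sol: "solution U" "solution V"
    and range: "\<And>t x. U t x \<in> {0..1}" "\<And>t x. V t x \<in> {0..1}"
    and stable: "\<And>t x. t \<le> T \<Longrightarrow> U t x > V t x \<Longrightarrow> U t x \<le> \<delta> \<or> 1 - \<delta> \<le> V t x"
    and "t \<le> T"
  shows "U t x \<le> V t x"
proof -
  obtain wt g H where w: "parabolic_jet (\<lambda>t x. U t x - V t x) wt g H"
    "\<And>t x. wt t x = tr_hess (a x) (H t x) + b x \<bullet> g t x + (F x (U t x) - F x (V t x))"
    using solution_diff[OF sol] by blast
  have "U t x - V t x \<le> 0"
  proof (rule ancient_max_principle[OF w(1) coeffs \<gamma>_pos _ _ \<open>t \<le> T\<close>])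
    show "U s y - V s y \<le> 1" if "s \<le> T" for s y
      using range(1)[of s y] range(2)[of s y] by simp
    show "wt s y \<le> tr_hess (a y) (H s y) + b y \<bullet> g s y - \<gamma> * (U s y - V s y)"
      if "s \<le> T" "U s y - V s y > 0" for s y
      using stable[OF that(1), of y] that(2) range(1)[of s y] range(2)[of s y]
        F_stable_0[of "V s y" "U s y" y] F_stable_1[of "V s y" "U s y" y] w(2)[of s y] by auto
  qed
  then show ?thesis by simp
qed

text \<open>The weight \<open>r\<close> turns the Lipschitz growth rate \<open>K\<close> into
  absorption at rate 1. It blows up in the past, but up to \<open>T0\<close> the difference is
  nonpositive, so the weighted difference is bounded above and the ancient principle
  applies.\<close>

lemma forward_comparison:
  assumes sol: "solution U" "solution V"
    and range: "\<And>t x. U t x \<in> {0..1}" "\<And>t x. V t x \<in> {0..1}"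
    and init: "\<And>t x. t \<le> T0 \<Longrightarrow> U t x \<le> V t x"
  shows "U t x \<le> V t x"
proof -
  obtain wt g H where w: "parabolic_jet (\<lambda>t x. U t x - V t x) wt g H"
    "\<And>t x. wt t x = tr_hess (a x) (H t x) + b x \<bullet> g t x + (F x (U t x) - F x (V t x))"
    using solution_diff[OF sol] by blast
  define r where "r = (\<lambda>t. exp (- (K + 1) * (t - T0)))"
  have rpos: "r t > 0" for t by (simp add: r_def)
  have jet: "parabolic_jet (\<lambda>t x. r t * (U t x - V t x))
      (\<lambda>t x. r t * wt t x + (- (K + 1) * r t) * (U t x - V t x)) (\<lambda>t x. r t *\<^sub>R g t x)
      (\<lambda>t x h. r t *\<^sub>R H t x h)"
    by (rule parabolic_jet_time_factor[OF w(1)]) (auto intro!: derivative_eq_intros simp: r_def)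
  have "r t * (U t x - V t x) \<le> 0"
  proof (rule ancient_max_principle[OF jet coeffs zero_less_one _ _ order_refl])
    show "r s * (U s y - V s y) \<le> 1" for s y
    proof (cases "s \<le> T0")
      case True
      then have "r s * (U s y - V s y) \<le> 0"
        using init[OF True, of y] rpos[of s] by (intro mult_nonneg_nonpos) auto
      then show ?thesis by simp
    next
      case False
      then have "r s \<le> 1" unfolding r_def using K_nonneg by (simp add: mult_nonpos_nonneg)
      then have "r s * (U s y - V s y) \<le> r s * 1"
        using rpos[of s] range(1)[of s y] range(2)[of s y] by (intro mult_left_mono) auto
      then show ?thesis using \<open>r s \<le> 1\<close> by simp
    qed
    show "r s * wt s y + (- (K + 1) * r s) * (U s y - V s y)
      \<le> tr_hess (a y) (\<lambda>h. r s *\<^sub>R H s y h) + b y \<bullet> (r s *\<^sub>R g s y) - 1 * (r s * (U s y - V s y))"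
      if "r s * (U s y - V s y) > 0" for s y
    proof -
      have "U s y - V s y > 0" using that rpos[of s] by (simp add: zero_less_mult_iff)
      then have "F y (U s y) - F y (V s y) \<le> K * (U s y - V s y)"
        using F_lipschitz[OF range(1)[of s y] range(2)[of s y], of y] by (simp add: abs_le_iff)
      then have "r s * (F y (U s y) - F y (V s y)) \<le> r s * (K * (U s y - V s y))"
        using rpos[of s] by (intro mult_left_mono) auto
      then show ?thesis by (simp add: w(2) tr_hess_scale algebra_simps)
    qed
  qed
  then show ?thesis using rpos[of t] by (simp add: mult_le_0_iff)
qed

lemma strong_comparison:
  assumes sol: "solution U" "solution V"
    and range: "\<And>t x. U t x \<in> {0..1}" "\<And>t x. V t x \<in> {0..1}"
    and le: "\<And>t x. V t x \<le> U t x"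
    and "t1 < t0" and less: "V t1 x1 < U t1 x1"
  shows "V t0 x0 < U t0 x0"
proof -
  obtain wt g H where w: "parabolic_jet (\<lambda>t x. U t x - V t x) wt g H"
    "\<And>t x. wt t x = tr_hess (a x) (H t x) + b x \<bullet> g t x + (F x (U t x) - F x (V t x))"
    using solution_diff[OF sol] by blast
  have "U t0 x0 - V t0 x0 > 0"
  proof (rule strong_max_principle[OF w(1) coeffs _ _ K_nonneg \<open>t1 < t0\<close>])
    show "U t x - V t x \<ge> 0" for t x using le[of t x] by simp
    show "wt t x \<ge> tr_hess (a x) (H t x) + b x \<bullet> g t x - K * (U t x - V t x)" for t x
      using F_lipschitz[OF range(1)[of t x] range(2)[of t x], of x] le[of t x] by (simp add: w(2) abs_le_iff)
    show "U t1 x1 - V t1 x1 > 0" using less by simp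
  qed
  then show ?thesis by simp
qed

lemma solution_time_shift:
  assumes "solution U"
  shows "solution (\<lambda>t. U (t + s))"
proof -
  obtain Ut g H where U: "parabolic_jet U Ut g H"
    "\<And>t x. Ut t x = tr_hess (a x) (H t x) + b x \<bullet> g t x + F x (U t x)"
    using assms unfolding solution_def by blast
  have "parabolic_jet (\<lambda>t. U (t + s)) (\<lambda>t. Ut (t + s)) (\<lambda>t. g (t + s)) (\<lambda>t. H (t + s))"
    unfolding parabolic_jet_def
  proof (intro conjI allI)
    show "continuous_on UNIV (\<lambda>(t, x). U (t + s) x)"
      unfolding case_prod_unfold
      by (rule continuous_on_compose2[OF parabolic_jetD(1)[OF U(1), unfolded case_prod_unfold],
            of _ "\<lambda>p. (fst p + s, snd p)", simplified])
        (intro continuous_intros)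
    fix t x
    show "((\<lambda>t. U (t + s) x) has_real_derivative Ut (t + s) x) (at t)"
      using parabolic_jetD(2)[OF U(1), of x "t + s"] by (simp add: DERIV_shift)
  qed (rule parabolic_jetD[OF U(1)])+
  then show ?thesis unfolding solution_def using U(2) by blast
qed

section \<open>Fronts: tails, speeds, sliding and contact\<close>

definition front :: "real \<Rightarrow> real ^ 'n \<Rightarrow> (real \<Rightarrow> real ^ 'n \<Rightarrow> real) \<Rightarrow> real \<Rightarrow> bool" where
  "front L e \<phi> c \<longleftrightarrow> (\<forall>\<xi> y. 0 < \<phi> \<xi> y \<and> \<phi> \<xi> y < 1) \<and>
     solution (\<lambda>t x. \<phi> (x \<bullet> e - c * t) (x /\<^sub>R L)) \<and> (\<forall>\<xi>. periodic (\<phi> \<xi>)) \<and>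
     uniform_limit UNIV \<phi> (\<lambda>_. 1) at_bot \<and> uniform_limit UNIV \<phi> (\<lambda>_. 0) at_top"

lemma frontD:
  assumes "front L e \<phi> c"
  shows "\<phi> \<xi> y \<in> {0..1}" "0 < \<phi> \<xi> y" "\<phi> \<xi> y < 1"
    and "solution (\<lambda>t x. \<phi> (x \<bullet> e - c * t) (x /\<^sub>R L))" "periodic (\<phi> \<xi>)"
  using assms unfolding front_def by (auto intro: less_imp_le)

lemma front_tails:
  assumes "front L e \<phi> c" "\<epsilon> > 0"
  obtains R where "\<And>\<xi> y. \<xi> \<le> - R \<Longrightarrow> \<phi> \<xi> y > 1 - \<epsilon>" "\<And>\<xi> y. \<xi> \<ge> R \<Longrightarrow> \<phi> \<xi> y < \<epsilon>"
proof -
  have "uniform_limit UNIV \<phi> (\<lambda>_. 1) at_bot" "uniform_limit UNIV \<phi> (\<lambda>_. 0) at_top"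
    using assms(1) by (auto simp: front_def)
  note lim = uniform_limitD[OF this(1) assms(2)] uniform_limitD[OF this(2) assms(2)]
  obtain R1 where R1: "\<And>\<xi> y. \<xi> \<le> R1 \<Longrightarrow> dist (\<phi> \<xi> y) 1 < \<epsilon>"
    using lim(1) unfolding eventually_at_bot_linorder by blast
  obtain R2 where R2: "\<And>\<xi> y. \<xi> \<ge> R2 \<Longrightarrow> dist (\<phi> \<xi> y) 0 < \<epsilon>"
    using lim(2) unfolding eventually_at_top_linorder by blast
  show ?thesis
  proof (rule that[of "max (- R1) R2"])
    show "\<phi> \<xi> y > 1 - \<epsilon>" if "\<xi> \<le> - max (- R1) R2" for \<xi> y
      using R1[of \<xi> y] that by (auto simp: dist_real_def max_def abs_less_iff split: if_splits)
    show "\<phi> \<xi> y < \<epsilon>" if "\<xi> \<ge> max (- R1) R2" for \<xi> y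
      using R2[of \<xi> y] that by (auto simp: dist_real_def)
  qed
qed

text \<open>
  For very negative times a faster front lies far behind a slower one and hence below it; by
  comparison it stays there, although it overtakes the slower one eventually.
\<close>

lemma front_speed_le:
  assumes fr: "front L e \<phi> c" "front L e \<psi> d" and e: "norm e = 1"
  shows "c \<le> d"
proof (rule ccontr)
  assume "\<not> c \<le> d"
  define U where "U = (\<lambda>t x. \<phi> (x \<bullet> e - c * t) (x /\<^sub>R L))"
  define V where "V = (\<lambda>t x. \<psi> (x \<bullet> e - d * t) (x /\<^sub>R L))"
  have sol: "solution U" "solution V" using fr by (auto simp: front_def U_def V_def)
  have range: "U t x \<in> {0..1}" "V t x \<in> {0..1}" for t x
    unfolding U_def V_def using fr frontD(1) by blast+
  obtain R where R: "\<And>\<xi> y. \<xi> \<ge> R \<Longrightarrow> \<phi> \<xi> y < \<delta>" using front_tails[OF fr(1) \<delta>_pos] by metis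
  obtain R' where R': "\<And>\<xi> y. \<xi> \<le> - R' \<Longrightarrow> \<psi> \<xi> y > 1 - \<delta>" using front_tails[OF fr(2) \<delta>_pos] by metis
  \<comment> \<open>Up to this time the zone where \<phi> may exceed \<delta> lies entirely where
    \<psi> is above 1 - \<delta>.\<close>
  define T0 where "T0 = - (R + R') / (c - d)"
  have early: "U t x \<le> V t x" if "t \<le> T0" for t x
  proof (rule stable_comparison[OF sol range _ that])
    fix t x assume "t \<le> T0"
    then have "(c - d) * t \<le> (c - d) * T0" using \<open>\<not> c \<le> d\<close> by (intro mult_left_mono) auto
    also have "\<dots> = - (R + R')" using \<open>\<not> c \<le> d\<close> by (simp add: T0_def)
    finally have *: "c * t + R \<le> d * t - R'" by (simp add: algebra_simps)
    show "U t x \<le> \<delta> \<or> 1 - \<delta> \<le> V t x"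
    proof (cases "x \<bullet> e \<ge> c * t + R")
      case True
      then show ?thesis using R[of "x \<bullet> e - c * t" "x /\<^sub>R L"] by (simp add: U_def)
    next
      case False
      then show ?thesis using R'[of "x \<bullet> e - d * t" "x /\<^sub>R L"] * by (simp add: V_def)
    qed
  qed
  have le: "U t x \<le> V t x" for t x by (rule forward_comparison[OF sol range early])
  obtain Q where Q: "\<And>\<xi> y. \<xi> \<le> - Q \<Longrightarrow> \<phi> \<xi> y > 1 - 1/2" using front_tails[OF fr(1) half_gt_zero[OF zero_less_one]] by metis
  obtain Q' where Q': "\<And>\<xi> y. \<xi> \<ge> Q' \<Longrightarrow> \<psi> \<xi> y < 1/2" using front_tails[OF fr(2) half_gt_zero[OF zero_less_one]] by metis
  \<comment> \<open>At this time the level 1/2 of the faster front has passed that of the slower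
    one, and \<open>x\<close> lies between them.\<close>
  define t where "t = (Q + Q') / (c - d)"
  define x where "x = (d * t + Q') *\<^sub>R e"
  have ee: "e \<bullet> e = 1" using e by (simp add: norm_eq_1)
  have "(c - d) * t = Q + Q'" using \<open>\<not> c \<le> d\<close> by (simp add: t_def)
  then have "x \<bullet> e - c * t \<le> - Q" "x \<bullet> e - d * t \<ge> Q'"
    by (simp_all add: x_def ee algebra_simps)
  then have "U t x > 1/2" "V t x < 1/2" using Q Q' by (force simp: U_def V_def)+
  then show False using le[of t x] by simp
qed

text \<open>For a nonzero speed the change of variables from (t, x) to (\<xi>, y) is invertible, so
  joint continuity of the solution carries over to the profile.\<close>

lemma front_continuous:
  assumes "front L e \<phi> c" "c \<noteq> 0" "L > 0"
  shows "continuous_on UNIV (\<lambda>p. \<phi> (fst p) (snd p))"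
proof -
  obtain Ut g H where U: "parabolic_jet (\<lambda>t x. \<phi> (x \<bullet> e - c * t) (x /\<^sub>R L)) Ut g H"
    using frontD(4)[OF assms(1)] unfolding solution_def by blast
  have "continuous_on UNIV (\<lambda>p::real \<times> (real ^ 'n). (((L *\<^sub>R snd p) \<bullet> e - fst p) / c, L *\<^sub>R snd p))"
    by (intro continuous_intros) (use assms in auto)
  then have "continuous_on UNIV (\<lambda>p. (\<lambda>(t, x). \<phi> (x \<bullet> e - c * t) (x /\<^sub>R L))
      (((L *\<^sub>R snd p) \<bullet> e - fst p) / c, L *\<^sub>R snd p))"
    by (intro continuous_on_compose2[OF parabolic_jetD(1)[OF U]]) auto
  then show ?thesis using assms by simp
qed

text \<open>Moving the profile by \<open>s\<close> is a time shift by \<open>s / c\<close>. The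
  alternative holds vacuously where the order is already known, so an ordering on the transition
  zone extends to the tails.\<close>

lemma front_slide:
  assumes fr: "front L e \<phi> c" "front L e \<psi> c" and "c \<noteq> 0" "L > 0"
    and stable: "\<And>\<xi> y. \<psi> \<xi> y > \<phi> (\<xi> - s) y \<Longrightarrow> \<psi> \<xi> y \<le> \<delta> \<or> 1 - \<delta> \<le> \<phi> (\<xi> - s) y"
  shows "\<psi> \<xi> y \<le> \<phi> (\<xi> - s) y"
proof -
  define U where "U = (\<lambda>t x. \<phi> (x \<bullet> e - c * (t + s / c)) (x /\<^sub>R L))"
  define V where "V = (\<lambda>t x. \<psi> (x \<bullet> e - c * t) (x /\<^sub>R L))"
  have sol: "solution U" "solution V"
    unfolding U_def V_def using frontD(4)[OF fr(2)] solution_time_shift[OF frontD(4)[OF fr(1)]] by auto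
  have range: "U t x \<in> {0..1}" "V t x \<in> {0..1}" for t x
    unfolding U_def V_def using fr frontD(1) by blast+
  have Ueq: "U t x = \<phi> (x \<bullet> e - c * t - s) (x /\<^sub>R L)" for t x
    using \<open>c \<noteq> 0\<close> by (simp add: U_def algebra_simps)
  define t where "t = ((L *\<^sub>R y) \<bullet> e - \<xi>) / c"
  have "V t (L *\<^sub>R y) \<le> U t (L *\<^sub>R y)"
    by (rule stable_comparison[OF sol(2,1) range(2,1) _ order_refl])
      (use stable in \<open>auto simp: Ueq V_def\<close>)
  then show ?thesis using \<open>c \<noteq> 0\<close> \<open>L > 0\<close> by (simp add: Ueq V_def t_def)
qed

text \<open>
  Integer translations of \<open>x\<close> in a direction not orthogonal to \<open>e\<close> move any point of the profile to
  arbitrarily negative times.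
\<close>

lemma front_touching:
  assumes fr: "front L e \<phi> c" "front L e \<psi> c" and "c \<noteq> 0" "L > 0" "e \<noteq> 0"
    and le: "\<And>\<xi> y. \<psi> \<xi> y \<le> \<phi> (\<xi> - s) y"
    and touch: "\<psi> \<xi>0 y0 = \<phi> (\<xi>0 - s) y0"
  shows "\<psi> \<xi> y = \<phi> (\<xi> - s) y"
proof (rule ccontr)
  assume "\<psi> \<xi> y \<noteq> \<phi> (\<xi> - s) y"
  then have less: "\<psi> \<xi> y < \<phi> (\<xi> - s) y" using le[of \<xi> y] by simp
  define U where "U = (\<lambda>t x. \<phi> (x \<bullet> e - c * (t + s / c)) (x /\<^sub>R L))"
  define V where "V = (\<lambda>t x. \<psi> (x \<bullet> e - c * t) (x /\<^sub>R L))"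
  have sol: "solution U" "solution V"
    unfolding U_def V_def using frontD(4)[OF fr(2)] solution_time_shift[OF frontD(4)[OF fr(1)]] by auto
  have range: "U t x \<in> {0..1}" "V t x \<in> {0..1}" for t x
    unfolding U_def V_def using fr frontD(1) by blast+
  have Ueq: "U t x = \<phi> (x \<bullet> e - c * t - s) (x /\<^sub>R L)" for t x
    using \<open>c \<noteq> 0\<close> by (simp add: U_def algebra_simps)
  define t0 where "t0 = ((L *\<^sub>R y0) \<bullet> e - \<xi>0) / c"
  obtain i where i: "e $ i \<noteq> 0" using \<open>e \<noteq> 0\<close> by (auto simp: vec_eq_iff)
  \<comment> \<open>Raising coordinate \<open>i\<close> of \<open>y\<close> by 1 with \<xi> fixed
    changes the time by \<alpha>; the sign of \<alpha> decides the direction of translation.\<close>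
  define \<alpha> where "\<alpha> = L * (e $ i) / c"
  have "\<alpha> \<noteq> 0" using i assms(3,4) by (simp add: \<alpha>_def)
  define \<tau> where "\<tau> = ((L *\<^sub>R y) \<bullet> e - \<xi>) / c"
  obtain m :: int where m: "\<tau> + of_int m * \<alpha> < t0"
  proof (cases "\<alpha> > 0")
    case True
    show ?thesis
    proof (rule that[of "\<lfloor>(t0 - \<tau>) / \<alpha>\<rfloor> - 1"])
      have "of_int (\<lfloor>(t0 - \<tau>) / \<alpha>\<rfloor> - 1) < (t0 - \<tau>) / \<alpha>" by linarith
      then show "\<tau> + of_int (\<lfloor>(t0 - \<tau>) / \<alpha>\<rfloor> - 1) * \<alpha> < t0"
        using True by (simp add: pos_less_divide_eq)
    qed
  next
    case False
    then have "\<alpha> < 0" using \<open>\<alpha> \<noteq> 0\<close> by simp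
    show ?thesis
    proof (rule that[of "\<lceil>(t0 - \<tau>) / \<alpha>\<rceil> + 1"])
      have "of_int (\<lceil>(t0 - \<tau>) / \<alpha>\<rceil> + 1) > (t0 - \<tau>) / \<alpha>" by linarith
      then show "\<tau> + of_int (\<lceil>(t0 - \<tau>) / \<alpha>\<rceil> + 1) * \<alpha> < t0"
        using \<open>\<alpha> < 0\<close> by (simp add: neg_divide_less_eq)
    qed
  qed
  define k :: "real ^ 'n" where "k = axis i (of_int m)"
  have k: "k $ j \<in> \<int>" for j by (simp add: k_def axis_def)
  define t1 where "t1 = \<tau> + of_int m * \<alpha>"
  \<comment> \<open>The pair (t1, x1) represents the profile point (\<xi>, y + k), where the strict
    inequality holds by periodicity; it precedes the contact at \<open>t0\<close>.\<close>
  define x1 where "x1 = L *\<^sub>R (y + k)"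
  have "c * t1 = x1 \<bullet> e - \<xi>"
    using \<open>c \<noteq> 0\<close> \<open>L > 0\<close>
    by (simp add: t1_def x1_def \<tau>_def \<alpha>_def k_def inner_add_left inner_axis' field_simps)
  then have "V t1 x1 = \<psi> \<xi> (y + k)" "U t1 x1 = \<phi> (\<xi> - s) (y + k)"
    using \<open>L > 0\<close> by (simp_all add: V_def Ueq x1_def)
  then have "V t1 x1 < U t1 x1"
    using less periodic_shift(1)[OF frontD(5)[OF fr(1)] k] periodic_shift(1)[OF frontD(5)[OF fr(2)] k]
    by simp
  moreover have "V t x \<le> U t x" for t x unfolding V_def Ueq by (rule le)
  ultimately have "V t0 (L *\<^sub>R y0) < U t0 (L *\<^sub>R y0)"
    using strong_comparison[OF sol range] m unfolding t1_def by blast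
  then show False using touch \<open>c \<noteq> 0\<close> \<open>L > 0\<close> by (simp add: V_def Ueq t0_def)
qed

lemma front_unique:
  assumes fr: "front L e \<phi> c" "front L e \<psi> c" and "c \<noteq> 0" "L > 0" "e \<noteq> 0"
  shows "\<exists>s. \<forall>\<xi> y. \<psi> \<xi> y = \<phi> (\<xi> - s) y"
proof -
  have cont: "continuous_on UNIV (\<lambda>p. \<phi> (fst p) (snd p))" "continuous_on UNIV (\<lambda>p. \<psi> (fst p) (snd p))"
    using front_continuous assms by blast+
  obtain R1 where R1: "\<And>\<xi> y. \<xi> \<le> - R1 \<Longrightarrow> \<phi> \<xi> y > 1 - \<delta>" using front_tails[OF fr(1) \<delta>_pos] by metis
  obtain R2 where R2: "\<And>\<xi> y. \<xi> \<ge> R2 \<Longrightarrow> \<psi> \<xi> y < \<delta>" using front_tails[OF fr(2) \<delta>_pos] by metis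
  define S where "S = {s. \<forall>\<xi> y. \<psi> \<xi> y \<le> \<phi> (\<xi> - s) y}"
  \<comment> \<open>From \<open>R2\<close> on, \<psi> is below \<delta>; before \<open>R2\<close>,
    the shifted \<phi> is evaluated to the left of \<open>- R1\<close> and is above 1 -
    \<delta>.\<close>
  have "R1 + R2 \<in> S"
  proof -
    have "\<psi> \<xi> y \<le> \<phi> (\<xi> - (R1 + R2)) y" for \<xi> y
    proof (rule front_slide[OF fr \<open>c \<noteq> 0\<close> \<open>L > 0\<close>])
      fix \<xi> y
      show "\<psi> \<xi> y \<le> \<delta> \<or> 1 - \<delta> \<le> \<phi> (\<xi> - (R1 + R2)) y"
        using R1[of "\<xi> - (R1 + R2)" y] R2[of \<xi> y] by (cases "\<xi> \<ge> R2") auto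
    qed
    then show ?thesis by (simp add: S_def)
  qed
  \<comment> \<open>Shifting too far down would bring \<phi> below the positive number
    \<open>\<psi> 0 0\<close>, which bounds \<open>S\<close> from below.\<close>
  obtain R3 where R3: "\<And>\<xi> y. \<xi> \<ge> R3 \<Longrightarrow> \<phi> \<xi> y < \<psi> 0 0"
    using front_tails[OF fr(1) frontD(2)[OF fr(2)]] by metis
  have bdd: "bdd_below S"
  proof (rule bdd_belowI[of _ "- R3"])
    fix s assume "s \<in> S"
    then have "\<psi> 0 0 \<le> \<phi> (- s) 0" by (auto simp: S_def dest: spec[of _ 0])
    then show "- R3 \<le> s" using R3[of "- s" 0] by linarith
  qed
  define s where "s = Inf S"
  \<comment> \<open>\<open>S\<close> is closed: a failure of the inequality at one point would
    persist for all shifts near \<open>s\<close>, and some of these belong to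
    \<open>S\<close>.\<close>
  have le: "\<psi> \<xi> y \<le> \<phi> (\<xi> - s) y" for \<xi> y
  proof (rule ccontr)
    assume "\<not> \<psi> \<xi> y \<le> \<phi> (\<xi> - s) y"
    moreover have "continuous_on UNIV (\<lambda>r. \<phi> (\<xi> - r) y)"
      by (rule continuous_on_compose2[OF cont(1), of _ "\<lambda>r. (\<xi> - r, y)", simplified])
        (intro continuous_intros)
    then have "isCont (\<lambda>r. \<phi> (\<xi> - r) y) s"
      by (simp add: continuous_on_eq_continuous_at)
    then have "((\<lambda>r. \<phi> (\<xi> - r) y) \<longlongrightarrow> \<phi> (\<xi> - s) y) (nhds s)"
      by (simp add: isCont_def tendsto_at_iff_tendsto_nhds[where g = "\<lambda>r. \<phi> (\<xi> - r) y"])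
    ultimately have "\<forall>\<^sub>F r in nhds s. \<phi> (\<xi> - r) y < \<psi> \<xi> y"
      by (intro order_tendstoD(2)) auto
    then obtain d where d: "d > 0" "\<And>r. dist r s < d \<Longrightarrow> \<phi> (\<xi> - r) y < \<psi> \<xi> y"
      unfolding eventually_nhds_metric by auto
    obtain r where r: "r \<in> S" "r < s + d"
      using cInf_lessD[of S "s + d"] \<open>R1 + R2 \<in> S\<close> d(1) by (auto simp: s_def)
    have "s \<le> r" unfolding s_def by (rule cInf_lower[OF r(1) bdd])
    then have "\<phi> (\<xi> - r) y < \<psi> \<xi> y" using r(2) by (intro d(2)) (simp add: dist_real_def)
    then show False using r(1) by (auto simp: S_def not_less[symmetric])
  qed
  have "\<exists>\<xi> y. \<psi> \<xi> y = \<phi> (\<xi> - s) y"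
  proof (rule ccontr)
    assume "\<nexists>\<xi> y. \<psi> \<xi> y = \<phi> (\<xi> - s) y"
    then have less: "\<psi> \<xi> y < \<phi> (\<xi> - s) y" for \<xi> y using le[of \<xi> y] by (metis order_le_less)
    \<comment> \<open>The summand 1 leaves room for a further slide \<open>h\<close> of at most 1,
      so that outside this range one of the tail estimates still holds.\<close>
    define R where "R = max R1 R2 + \<bar>s\<bar> + 1"
    define Z :: "(real \<times> (real ^ 'n)) set" where "Z = {- R..R} \<times> cbox 0 (\<chi> i. 1)"
    \<comment> \<open>The gap between the fronts after a further slide, the first component of
      \<open>q\<close>; the second component is a profile point.\<close>
    define G where "G = (\<lambda>q. \<phi> (fst (snd q) - s + fst q) (snd (snd q)) - \<psi> (fst (snd q)) (snd (snd q)))"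
    have contG: "continuous_on UNIV G"
      unfolding G_def
      by (intro continuous_on_diff
          continuous_on_compose2[OF cont(1), of _ "\<lambda>q. (fst (snd q) - s + fst q, snd (snd q))", simplified]
          continuous_on_compose2[OF cont(2), of _ snd, simplified] continuous_intros)
    have Z: "compact Z" unfolding Z_def by (intro compact_Times) auto
    obtain m where m: "m > 0" "\<And>p. p \<in> Z \<Longrightarrow> G (0, p) \<ge> m"
    \<comment> \<open>\<open>R1\<close> and \<open>R2\<close> may be negative, so the range of \<xi>
      may be empty.\<close>
    proof (cases "Z = {}")
      case True
      then show ?thesis using that[of 1] by simp
    next
      case False
      have "continuous_on Z (\<lambda>p. G (0, p))"
        by (rule continuous_on_compose2[OF contG]) (auto intro: continuous_intros)
      from continuous_attains_inf[OF Z False this]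
      obtain p where "p \<in> Z" "\<And>q. q \<in> Z \<Longrightarrow> G (0, p) \<le> G (0, q)" by blast
      then show ?thesis using less by (intro that[of "G (0, p)"]) (auto simp: G_def)
    qed
    \<comment> \<open>Uniform continuity provides a single positive slide that keeps the gap
      positive on all of \<open>Z\<close>.\<close>
    have "uniformly_continuous_on ({0..1} \<times> Z) G"
      by (intro compact_uniformly_continuous compact_Times Z continuous_on_subset[OF contG]) auto
    then obtain d where d: "d > 0"
      "\<And>p q. p \<in> {0..1} \<times> Z \<Longrightarrow> q \<in> {0..1} \<times> Z \<Longrightarrow> dist q p < d \<Longrightarrow> dist (G q) (G p) < m"
      unfolding uniformly_continuous_on_def using m(1) by metis
    define h where "h = min d 1 / 2"
    have h: "0 < h" "h < d" "h \<le> 1" using d(1) by (auto simp: h_def)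
    have mid: "\<psi> \<xi> y < \<phi> (\<xi> - s + h) y" if "\<bar>\<xi>\<bar> \<le> R" for \<xi> y
    proof -
      obtain k where k: "\<And>i. k $ i \<in> \<int>" "y - k \<in> cbox 0 (\<chi> i. 1)" using periodic_reduce by blast
      have inZ: "(\<xi>, y - k) \<in> Z" using that k(2) by (auto simp: Z_def)
      have "dist (h, (\<xi>, y - k)) (0, (\<xi>, y - k)) < d" using h by (simp add: dist_Pair_Pair)
      then have "dist (G (h, (\<xi>, y - k))) (G (0, (\<xi>, y - k))) < m"
        using h inZ by (intro d(2)) auto
      then have "G (h, (\<xi>, y - k)) > 0" using m(2)[OF inZ] by (simp add: dist_real_def)
      then show ?thesis
        using periodic_shift(2)[OF frontD(5)[OF fr(1)] k(1)] periodic_shift(2)[OF frontD(5)[OF fr(2)] k(1)]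
        by (simp add: G_def)
    qed
    have "\<psi> \<xi> y \<le> \<phi> (\<xi> - (s - h)) y" for \<xi> y
    proof (rule front_slide[OF fr \<open>c \<noteq> 0\<close> \<open>L > 0\<close>])
      fix \<xi> y assume gt: "\<psi> \<xi> y > \<phi> (\<xi> - (s - h)) y"
      then have "\<not> \<bar>\<xi>\<bar> \<le> R" using mid[of \<xi> y] by (auto simp: algebra_simps)
      then consider "\<xi> \<ge> R2" | "\<xi> - (s - h) \<le> - R1"
        using h by (auto simp: R_def abs_if split: if_splits)
      then show "\<psi> \<xi> y \<le> \<delta> \<or> 1 - \<delta> \<le> \<phi> (\<xi> - (s - h)) y"
        using R1[of "\<xi> - (s - h)" y] R2[of \<xi> y] by cases auto
    qed
    then have "s - h \<in> S" by (simp add: S_def)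
    then have "s \<le> s - h" unfolding s_def by (rule cInf_lower[OF _ bdd])
    then show False using h by simp
  qed
  then show ?thesis using front_touching[OF fr \<open>c \<noteq> 0\<close> \<open>L > 0\<close> \<open>e \<noteq> 0\<close> le] by blast
qed

end

section \<open>Reduction to nondivergence form\<close>

lemma linear_eq_inner_axis:
  fixes G :: "real ^ 'n \<Rightarrow> real"
  assumes "linear G"
  shows "G h = (\<chi> i. G (axis i 1)) \<bullet> h"
proof -
  have "h = (\<Sum>i\<in>UNIV. h $ i *\<^sub>R axis i 1)"
    using basis_expansion[of h] by (simp add: scalar_mult_eq_scaleR)
  then have "G h = (\<Sum>i\<in>UNIV. G (h $ i *\<^sub>R axis i 1))" by (metis assms linear_sum)
  then show ?thesis by (simp add: linear_cmul[OF assms] inner_vec_def mult.commute)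
qed

lemma class_C12_parabolic_jet:
  assumes "class_C12 U"
  shows "parabolic_jet U (\<lambda>t x. deriv (\<lambda>s. U s x) t) (\<lambda>t x. grad (U t) x)
    (\<lambda>t x. frechet_derivative (grad (U t)) (at x))"
  unfolding parabolic_jet_def
proof (intro conjI allI)
  show "continuous_on UNIV (\<lambda>(t, x). U t x)" using assms by (simp add: class_C12_def)
  fix t x
  show "((\<lambda>s. U s x) has_real_derivative deriv (\<lambda>s. U s x) t) (at t)"
    using assms unfolding class_C12_def
    by (metis DERIV_deriv_iff_real_differentiable)
  have d: "(U t has_derivative frechet_derivative (U t) (at x)) (at x)"
    using assms unfolding class_C12_def by (simp flip: frechet_derivative_works)
  then have "linear (frechet_derivative (U t) (at x))" by (rule has_derivative_linear)
  then have "frechet_derivative (U t) (at x) = (\<lambda>h. grad (U t) x \<bullet> h)"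
    unfolding grad_def using linear_eq_inner_axis by blast
  then show "(U t has_derivative (\<lambda>h. grad (U t) x \<bullet> h)) (at x)" using d by metis
  show "(grad (U t) has_derivative frechet_derivative (grad (U t)) (at x)) (at x)"
    using assms unfolding class_C12_def by (simp flip: frechet_derivative_works)
qed

lemma bounded_bilinear_matrix_vector: "bounded_bilinear ((*v) :: real ^ 'n ^ 'm \<Rightarrow> real ^ 'n \<Rightarrow> real ^ 'm)"
proof -
  have "bilinear ((*v) :: real ^ 'n ^ 'm \<Rightarrow> real ^ 'n \<Rightarrow> real ^ 'm)"
    unfolding bilinear_def
  proof (intro conjI allI)
    show "linear (\<lambda>a :: real ^ 'n ^ 'm. a *v y)" for y
      by (rule linearI) (simp_all add: matrix_vector_mult_add_rdistrib scaleR_matrix_vector_assoc)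
  qed simp
  then show ?thesis by (simp add: bilinear_conv_bounded_bilinear)
qed

text \<open>The columnwise divergence of a matrix field with derivative \<open>A'\<close>; it
  becomes a drift when the divergence form is expanded.\<close>

definition matrix_div :: "(real ^ 'n \<Rightarrow> real ^ 'n ^ 'n) \<Rightarrow> real ^ 'n" where
  "matrix_div A' = (\<chi> j. \<Sum>i\<in>UNIV. A' (axis i 1) $ i $ j)"

lemma divergence_matrix_mult:
  fixes A :: "real ^ 'n \<Rightarrow> real ^ 'n ^ 'n"
  assumes A: "(A has_derivative A') (at x)" and g: "(g has_derivative H) (at x)"
  shows "divergence (\<lambda>z. A z *v g z) x = tr_hess (A x) H + matrix_div A' \<bullet> g x"
proof -
  have "((\<lambda>z. A z *v g z) has_derivative (\<lambda>h. A x *v H h + A' h *v g x)) (at x)"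
    by (rule bounded_bilinear.FDERIV[OF bounded_bilinear_matrix_vector A g])
  then have "frechet_derivative (\<lambda>z. A z *v g z) (at x) = (\<lambda>h. A x *v H h + A' h *v g x)"
    by (rule frechet_derivative_at[symmetric])
  then have "divergence (\<lambda>z. A z *v g z) x
      = tr_hess (A x) H + (\<Sum>i\<in>UNIV. \<Sum>j\<in>UNIV. A' (axis i 1) $ i $ j * g x $ j)"
    by (simp add: divergence_def tr_hess_def sum.distrib matrix_vector_mult_def)
  also have "(\<Sum>i\<in>UNIV. \<Sum>j\<in>UNIV. A' (axis i 1) $ i $ j * g x $ j) = matrix_div A' \<bullet> g x"
    unfolding inner_vec_def matrix_div_def by (subst sum.swap) (simp add: sum_distrib_right)
  finally show ?thesis .
qed

section \<open>Uniform bounds from periodicity, compactness and one-sided derivatives\<close>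

lemma Ck_on_continuous_on: "Ck_on k S g \<Longrightarrow> continuous_on S g"
  by (cases k) (auto intro: has_derivative_continuous_on)

lemma Ck_on_SucD:
  assumes "Ck_on (Suc k) S g"
  obtains g' where "\<And>x. x \<in> S \<Longrightarrow> (g has_derivative g' x) (at x within S)"
    "\<And>v. continuous_on S (\<lambda>x. g' x v)"
  using assms by (auto dest: Ck_on_continuous_on)

lemma periodic_continuous_bounded:
  fixes g :: "real ^ 'n \<Rightarrow> 'b::real_normed_vector"
  assumes "periodic g" "continuous_on UNIV g"
  obtains M where "\<And>x. norm (g x) \<le> M"
proof -
  have "compact (g ` cbox 0 (\<chi> i. 1))"
    by (intro compact_continuous_image continuous_on_subset[OF assms(2)]) auto
  then have "bounded (g ` cbox 0 (\<chi> i. 1))" by (rule compact_imp_bounded)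
  then obtain M where M: "\<And>y. y \<in> cbox 0 (\<chi> i. 1) \<Longrightarrow> norm (g y) \<le> M"
    unfolding bounded_iff by blast
  show ?thesis
  proof (rule that)
    fix x :: "real ^ 'n"
    obtain k where k: "\<And>i. k $ i \<in> \<int>" "x - k \<in> cbox 0 (\<chi> i. 1)"
      using periodic_reduce[of x] by blast
    show "norm (g x) \<le> M" using M[OF k(2)] periodic_shift(2)[OF assms(1) k(1)] by simp
  qed
qed

lemma periodic_derivative:
  fixes g :: "real ^ 'n \<Rightarrow> 'b::real_normed_vector"
  assumes "periodic g" "\<And>x. (g has_derivative g' x) (at x)"
  shows "periodic g'"
  unfolding periodic_def
proof (intro allI impI)
  fix x k :: "real ^ 'n" assume "\<forall>i. k $ i \<in> \<int>"
  then have "(\<lambda>z. g (z + k)) = g" using assms(1) by (auto simp: periodic_def)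
  moreover have "((\<lambda>z. g (z + k)) has_derivative g' (x + k)) (at x)"
    by (rule has_derivative_compose[where f = "\<lambda>z. z + k" and f' = "\<lambda>h. h", OF _ assms(2)])
      (auto intro!: derivative_eq_intros)
  ultimately show "g' (x + k) = g' x"
    using assms(2) by (metis has_derivative_unique)
qed

text \<open>The drift \<open>b\<close> combines \<open>B\<close> with the divergence of the rescaled
  \<open>A\<close>. Before rescaling of its argument it is a continuous periodic function, hence
  bounded; the bound may depend on \<open>L\<close>, which stays fixed.\<close>

lemma scaled_coeffs:
  fixes A :: "real ^ 'n \<Rightarrow> real ^ 'n ^ 'n" and B :: "real ^ 'n \<Rightarrow> real ^ 'n"
  assumes A: "periodic A" "Ck_on 2 UNIV A" and el: "\<And>x. elliptic \<eta> (A x)" "\<eta> > 0"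
    and B: "periodic B" "continuous_on UNIV B"
  obtains C b where "admissible_coeffs \<eta> C (\<lambda>x. A (x /\<^sub>R L)) b"
    "\<And>g H x. (g has_derivative H) (at x) \<Longrightarrow>
      divergence (\<lambda>z. A (z /\<^sub>R L) *v g z) x + B (x /\<^sub>R L) \<bullet> g x = tr_hess (A (x /\<^sub>R L)) H + b x \<bullet> g x"
proof -
  have "Ck_on (Suc 1) UNIV A" using A(2) by (simp only: Suc_1)
  from Ck_on_SucD[OF this]
  obtain A' where A': "\<And>x. (A has_derivative A' x) (at x)" "\<And>v. continuous_on UNIV (\<lambda>x. A' x v)"
    by auto
  have contA: "continuous_on UNIV A" using A(2) by (rule Ck_on_continuous_on)
  have perA': "periodic A'" by (rule periodic_derivative[OF A(1) A'(1)])
  define \<beta> where "\<beta> = (\<lambda>y. matrix_div (\<lambda>h. A' y (h /\<^sub>R L)) + B y)"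
  have "periodic \<beta>" using perA' B(1) unfolding periodic_def \<beta>_def by metis
  moreover have "continuous_on UNIV \<beta>"
    unfolding \<beta>_def matrix_div_def
    by (intro continuous_on_add B(2) continuous_on_vec_lambda continuous_on_sum
        continuous_on_component A'(2))
  ultimately obtain M where M: "\<And>y. norm (\<beta> y) \<le> M" using periodic_continuous_bounded by blast
  obtain N where N: "\<And>y. norm (A y) \<le> N" using periodic_continuous_bounded[OF A(1) contA] by blast
  obtain k where k: "k > 0" "\<And>(a :: real ^ 'n ^ 'n) v :: real ^ 'n. norm (a *v v) \<le> norm a * norm v * k"
    using bounded_bilinear.pos_bounded[OF bounded_bilinear_matrix_vector] by blast
  define C where "C = max 1 (max (N * k) M)"
  have "admissible_coeffs \<eta> C (\<lambda>x. A (x /\<^sub>R L)) (\<lambda>x. \<beta> (x /\<^sub>R L))"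
    unfolding admissible_coeffs_def
  proof (intro conjI allI el)
    show "C > 0" by (simp add: C_def)
    fix x
    show "norm (\<beta> (x /\<^sub>R L)) \<le> C" using M[of "x /\<^sub>R L"] by (simp add: C_def)
    fix v :: "real ^ 'n"
    have "norm (A (x /\<^sub>R L) *v v) \<le> norm (A (x /\<^sub>R L)) * k * norm v"
      using k(2)[of "A (x /\<^sub>R L)" v] by (simp add: mult_ac)
    also have "\<dots> \<le> C * norm v"
    proof (rule mult_right_mono)
      have "norm (A (x /\<^sub>R L)) * k \<le> N * k" using N k(1) by simp
      then show "norm (A (x /\<^sub>R L)) * k \<le> C" by (simp add: C_def)
    qed simp
    finally show "norm (A (x /\<^sub>R L) *v v) \<le> C * norm v" .
  qed
  moreover have "divergence (\<lambda>z. A (z /\<^sub>R L) *v g z) x + B (x /\<^sub>R L) \<bullet> g x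
      = tr_hess (A (x /\<^sub>R L)) H + \<beta> (x /\<^sub>R L) \<bullet> g x"
    if "(g has_derivative H) (at x)" for g H x
  proof -
    have "((\<lambda>z. A (z /\<^sub>R L)) has_derivative (\<lambda>h. A' (x /\<^sub>R L) (h /\<^sub>R L))) (at x)"
      by (rule has_derivative_compose[where f = "\<lambda>z. z /\<^sub>R L", OF _ A'(1)])
        (auto intro!: derivative_eq_intros)
    from divergence_matrix_mult[OF this that] show ?thesis
      by (simp add: \<beta>_def inner_add_left)
  qed
  ultimately show ?thesis by (rule that)
qed

text \<open>The derivative in \<open>u\<close> is the joint derivative restricted to a vertical
  segment, one-sided at the ends. It is bounded over the compact unit cell, and periodicity of the
  values of \<open>f\<close> carries the Lipschitz estimate to every \<open>x\<close>.\<close>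

lemma reaction_lipschitz:
  fixes f :: "real ^ 'n \<Rightarrow> real \<Rightarrow> real"
  assumes "Ck_on (Suc k) (UNIV \<times> {0..1}) (\<lambda>(x, u). f x u)"
    and per: "\<And>u. u \<in> {0..1} \<Longrightarrow> periodic (\<lambda>x. f x u)"
  obtains K where "K \<ge> 0"
    "\<And>x u v. u \<in> {0..1} \<Longrightarrow> v \<in> {0..1} \<Longrightarrow> \<bar>f x u - f x v\<bar> \<le> K * \<bar>u - v\<bar>"
proof -
  obtain f' where f': "\<And>p. p \<in> UNIV \<times> {0..1} \<Longrightarrow>
      ((\<lambda>(x, u). f x u) has_derivative f' p) (at p within UNIV \<times> {0..1})"
    "\<And>v. continuous_on (UNIV \<times> {0..1}) (\<lambda>p. f' p v)"
    by (rule Ck_on_SucD[OF assms(1)]) (rule that)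
  define Q :: "(real ^ 'n) set" where "Q = cbox 0 (\<chi> i. 1)"
  have "compact ((\<lambda>p. f' p (0, 1)) ` (Q \<times> {0..1}))"
    unfolding Q_def
    by (intro compact_continuous_image continuous_on_subset[OF f'(2)] compact_Times) auto
  then have "bounded ((\<lambda>p. f' p (0, 1)) ` (Q \<times> {0..1}))" by (rule compact_imp_bounded)
  then obtain K where K: "\<And>p. p \<in> Q \<times> {0..1} \<Longrightarrow> \<bar>f' p (0, 1)\<bar> \<le> K"
    unfolding bounded_iff real_norm_def by blast
  have deriv: "(f x has_real_derivative f' (x, u) (0, 1)) (at u within {0..1})" if "u \<in> {0..1}" for x u
  proof -
    have "((\<lambda>(x, u). f x u) has_derivative f' (x, u)) (at (x, u) within UNIV \<times> {0..1})"
      using f'(1) that by auto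
    then have sub: "((\<lambda>(x, u). f x u) has_derivative f' (x, u)) (at (x, u) within Pair x ` {0..1})"
      by (rule has_derivative_subset) auto
    have "((\<lambda>u. (x, u)) has_derivative (\<lambda>h. (0, h))) (at u within {0..1})"
      by (intro has_derivative_Pair has_derivative_const has_derivative_ident)
    from has_derivative_in_compose[OF this sub]
    have "(f x has_derivative (\<lambda>h. f' (x, u) (0, h))) (at u within {0..1})" by simp
    moreover have "(\<lambda>h. f' (x, u) (0, h)) = (*) (f' (x, u) (0, 1))"
    proof
      fix h
      have "linear (f' (x, u))" using f'(1)[of "(x, u)"] that has_derivative_linear by auto
      from linear_cmul[OF this, of h "(0, 1)"]
      show "f' (x, u) (0, h) = f' (x, u) (0, 1) * h" by (simp add: mult.commute)
    qed
    ultimately show ?thesis unfolding has_field_derivative_def by (simp only:)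
  qed
  show ?thesis
  proof (rule that[of "max K 0"])
    fix x :: "real ^ 'n" and u v :: real assume uv: "u \<in> {0..1}" "v \<in> {0..1}"
    obtain k where k: "\<And>i. k $ i \<in> \<int>" "x - k \<in> Q"
      unfolding Q_def using periodic_reduce[of x] by blast
    have "norm (f (x - k) u - f (x - k) v) \<le> max K 0 * norm (u - v)"
      by (rule field_differentiable_bound[of "{0..1}", OF _ deriv])
        (use K k(2) uv in \<open>auto simp: le_max_iff_disj\<close>)
    then show "\<bar>f x u - f x v\<bar> \<le> max K 0 * \<bar>u - v\<bar>"
      using periodic_shift(2)[OF per k(1)] uv by simp
  qed simp
qed

text \<open>The mean value theorem on the interval from \<open>v\<close> to \<open>u\<close>, whose
  inclusion in [0, 1] turns the given derivatives into derivatives within it.\<close>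

lemma decreasing_of_derivative_le:
  fixes g :: "real \<Rightarrow> real"
  assumes d: "\<And>u. p \<le> u \<Longrightarrow> u \<le> q \<Longrightarrow> \<exists>d. (g has_real_derivative d) (at u within {0..1}) \<and> d \<le> - \<gamma>"
    and "0 \<le> p" "q \<le> 1" "p \<le> v" "v \<le> u" "u \<le> q"
  shows "g u - g v \<le> - \<gamma> * (u - v)"
proof (cases "v = u")
  case False
  then have "v < u" using assms by simp
  obtain g' where g': "\<And>w. p \<le> w \<Longrightarrow> w \<le> q \<Longrightarrow> (g has_real_derivative g' w) (at w within {0..1}) \<and> g' w \<le> - \<gamma>"
    using d by metis
  have "(g has_derivative (\<lambda>h. g' w * h)) (at w within {v..u})" if "w \<in> {v..u}" for w
  proof -
    have "(g has_derivative (*) (g' w)) (at w within {0..1})"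
      using g'[of w] that assms by (auto simp: has_field_derivative_def)
    then show ?thesis by (rule has_derivative_subset) (use assms in auto)
  qed
  from mvt_very_simple[OF assms(5) this]
  obtain w where w: "w \<in> {v..u}" "g u - g v = g' w * (u - v)" by auto
  then have "g' w \<le> - \<gamma>" using g'[of w] assms by auto
  then show ?thesis unfolding w(2) using \<open>v < u\<close> by (intro mult_right_mono) auto
qed simp

theorem corollary1p1:
  fixes A :: "real ^ 'n \<Rightarrow> real ^ 'n ^ 'n"
    and B :: "real ^ 'n \<Rightarrow> real ^ 'n"
    and f :: "real ^ 'n \<Rightarrow> real \<Rightarrow> real"
    and \<eta>\<^sub>0 \<gamma>\<^sub>0 \<delta>\<^sub>0 :: real
    and \<phi>\<^sub>0 :: "real ^ 'n \<Rightarrow> real \<Rightarrow> real"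
    and c\<^sub>0 :: "real ^ 'n \<Rightarrow> real"
    and e :: "real ^ 'n"
    and L_star :: real
    and \<phi> :: "real \<Rightarrow> real \<Rightarrow> real ^ 'n \<Rightarrow> real"
    and c :: "real \<Rightarrow> real"
  assumes A_periodic: "periodic A"
    and A_C2: "Ck_on 2 UNIV A"
    and \<eta>\<^sub>0_pos: "\<eta>\<^sub>0 > 0"
    and A_elliptic: "\<And>x \<xi>. (\<Sum>i\<in>UNIV. \<Sum>j\<in>UNIV. A x $ i $ j * \<xi> $ i * \<xi> $ j) \<ge> \<eta>\<^sub>0 * (norm \<xi>)\<^sup>2"
    and B_periodic: "periodic B"
    and B_C1: "Ck_on 1 UNIV B"
    and f_C3: "Ck_on 3 (UNIV \<times> {0..1}) (\<lambda>(x, u). f x u)"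
    and f_periodic: "\<And>u. u \<in> {0..1} \<Longrightarrow> periodic (\<lambda>x. f x u)"
    and f_zeros: "\<And>x. f x 0 = 0" "\<And>x. f x 1 = 0"
    and \<gamma>\<^sub>0_pos: "\<gamma>\<^sub>0 > 0"
    and \<delta>\<^sub>0_range: "0 < \<delta>\<^sub>0" "\<delta>\<^sub>0 < 1 / 2"
    and f_stable: "\<And>x u. u \<in> {0..\<delta>\<^sub>0} \<union> {1 - \<delta>\<^sub>0..1} \<Longrightarrow>
          \<exists>d. (f x has_real_derivative d) (at u within {0..1}) \<and> d \<le> - \<gamma>\<^sub>0"
    and homogenized_waves: "\<And>e'. norm e' = 1 \<Longrightarrow> homogenized_wave A B f e' (\<phi>\<^sub>0 e') (c\<^sub>0 e')"
    and e_unit: "norm e = 1"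
    and c\<^sub>0_nonzero: "c\<^sub>0 e \<noteq> 0"
    and L_star_pos: "L_star > 0"
    and moving_waves: "\<And>L. 0 < L \<Longrightarrow> L < L_star \<Longrightarrow>
          pulsating_wave A B f L e (\<phi> L) (c L) \<and> c L \<noteq> 0"
    and profile_convergence:
          "\<exists>s. H1_tendsto_zero (\<lambda>L (\<xi>, y). \<phi> L \<xi> y - \<phi>\<^sub>0 e (\<xi> + s)) (at_right 0)"
    and speed_convergence: "(c \<longlongrightarrow> c\<^sub>0 e) (at_right 0)"
  shows "\<forall>L. 0 < L \<and> L < L_star \<longrightarrow>
           (\<forall>\<phi>' c'. pulsating_wave A B f L e \<phi>' c' \<longrightarrow>
              c' = c L \<and> (\<exists>\<tau>\<^sub>0. \<forall>\<xi> y. \<phi>' \<xi> y = \<phi> L (\<xi> + \<tau>\<^sub>0) y))"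
proof (intro allI impI)
  fix L \<phi>' c'
  assume L: "0 < L \<and> L < L_star" and wave': "pulsating_wave A B f L e \<phi>' c'"
  have wave: "pulsating_wave A B f L e (\<phi> L) (c L)" and "c L \<noteq> 0"
    using moving_waves L by auto
  have el: "elliptic \<eta>\<^sub>0 (A x)" for x using A_elliptic by (simp add: elliptic_def)
  obtain C b where coeffs: "admissible_coeffs \<eta>\<^sub>0 C (\<lambda>x. A (x /\<^sub>R L)) b"
    and div: "\<And>g H x. (g has_derivative H) (at x) \<Longrightarrow>
      divergence (\<lambda>z. A (z /\<^sub>R L) *v g z) x + B (x /\<^sub>R L) \<bullet> g x = tr_hess (A (x /\<^sub>R L)) H + b x \<bullet> g x"
    by (rule scaled_coeffs[OF A_periodic A_C2 el \<eta>\<^sub>0_pos B_periodic Ck_on_continuous_on[OF B_C1], of L])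
      (rule that)
  obtain K where K: "K \<ge> 0"
    "\<And>x u v. u \<in> {0..1} \<Longrightarrow> v \<in> {0..1} \<Longrightarrow> \<bar>f x u - f x v\<bar> \<le> K * \<bar>u - v\<bar>"
    by (rule reaction_lipschitz[OF f_C3[unfolded numeral_3_eq_3] f_periodic], assumption) (rule that)
  interpret bistable_equation \<eta>\<^sub>0 C "\<lambda>x. A (x /\<^sub>R L)" b "\<lambda>x. f (x /\<^sub>R L)" K \<gamma>\<^sub>0 \<delta>\<^sub>0
  proof
    show "f (x /\<^sub>R L) u - f (x /\<^sub>R L) v \<le> - \<gamma>\<^sub>0 * (u - v)" if "0 \<le> v" "v \<le> u" "u \<le> \<delta>\<^sub>0" for x u v
      by (rule decreasing_of_derivative_le[OF f_stable]) (use that \<delta>\<^sub>0_range in auto)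
    show "f (x /\<^sub>R L) u - f (x /\<^sub>R L) v \<le> - \<gamma>\<^sub>0 * (u - v)" if "1 - \<delta>\<^sub>0 \<le> v" "v \<le> u" "u \<le> 1" for x u v
      by (rule decreasing_of_derivative_le[OF f_stable]) (use that \<delta>\<^sub>0_range in auto)
  qed (use coeffs K \<gamma>\<^sub>0_pos \<delta>\<^sub>0_range in auto)
  have front: "front L e \<psi> d" if "pulsating_wave A B f L e \<psi> d" for \<psi> d
  proof -
    define U where "U = (\<lambda>t x. \<psi> (x \<bullet> e - d * t) (x /\<^sub>R L))"
    have "entire_solution (\<lambda>x. A (x /\<^sub>R L)) (\<lambda>x. B (x /\<^sub>R L)) (\<lambda>x. f (x /\<^sub>R L)) U"
      using that by (simp add: pulsating_wave_def U_def)
    then have "class_C12 U"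
      and eq: "\<And>t x. deriv (\<lambda>s. U s x) t = divergence (\<lambda>z. A (z /\<^sub>R L) *v grad (U t) z) x
        + B (x /\<^sub>R L) \<bullet> grad (U t) x + f (x /\<^sub>R L) (U t x)"
      by (simp_all add: entire_solution_def)
    from class_C12_parabolic_jet[OF this(1)]
    have jet: "parabolic_jet U (\<lambda>t x. deriv (\<lambda>s. U s x) t) (\<lambda>t x. grad (U t) x)
        (\<lambda>t x. frechet_derivative (grad (U t)) (at x))" .
    have "solution U"
      unfolding solution_def by (intro exI conjI allI, rule jet)
        (simp add: eq div[OF parabolic_jetD(4)[OF jet]])
    then show ?thesis using that by (simp add: front_def pulsating_wave_def U_def)
  qed
  note fr = front[OF wave] front[OF wave']
  \<comment> \<open>The speed comparison is applied in both orders. It admits zero speeds, so this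
    also excludes a stationary competitor before the sliding argument begins.\<close>
  have speed: "c' = c L"
    using front_speed_le[OF fr e_unit] front_speed_le[OF fr(2,1) e_unit] by simp
  have "e \<noteq> 0" using e_unit by auto
  then obtain s where "\<And>\<xi> y. \<phi>' \<xi> y = \<phi> L (\<xi> - s) y"
    using front_unique[OF fr(1) fr(2)[unfolded speed] \<open>c L \<noteq> 0\<close>] L by blast
  then have "\<forall>\<xi> y. \<phi>' \<xi> y = \<phi> L (\<xi> + - s) y" by simp
  then show "c' = c L \<and> (\<exists>\<tau>\<^sub>0. \<forall>\<xi> y. \<phi>' \<xi> y = \<phi> L (\<xi> + \<tau>\<^sub>0) y)"
    using speed by blast
qed

end
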